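(* For every integer $k\geq 3$ with $k\notin\{4,6,8,10,12\}$, $n(k|k)=c(k|k)=2k$. Moreover, $n(4|4)=c(4|4)=7$, and for $k\in\{6,8,10,12\}$, $2k-1\leq n(k|k)\leq c(k|k)\leq 2k$.
   Context: An $(r|\chi)$-graph is a simple finite $r$-regular graph with chromatic number $\chi$. $n(r|\chi)$ is the minimum order of an $(r|\chi)$-graph and $c(r|\chi)$ is the minimum order of an $(r|\chi)$-graph which is a Cayley graph. *)

theory Defs
  imports "HOL-Algebra.Group" "Graph_Theory.Graph_Theory"
begin

definition proper_colouring :: "'a pair_pre_digraph \<Rightarrow> nat \<Rightarrow> ('a \<Rightarrow> nat) \<Rightarrow> bool" where
  "proper_colouring G m f \<longleftrightarrow>
     (\<forall>v \<in> pverts G. f v < m) \<and> (\<forall>(u, v) \<in> parcs G. f u \<noteq> f v)"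

definition chromatic_number :: "'a pair_pre_digraph \<Rightarrow> nat" where
  "chromatic_number G = (LEAST m. \<exists>f. proper_colouring G m f)"

text \<open>
  The locale \<^locale>\<open>pair_graph\<close> describes finite simple graphs as loopless symmetric digraphs,
  so the degree of a vertex is its out-degree.
\<close>

definition regular :: "nat \<Rightarrow> 'a pair_pre_digraph \<Rightarrow> bool" where
  "regular r G \<longleftrightarrow> (\<forall>v \<in> pverts G. out_degree (with_proj G) v = r)"

definition r_chi_graph :: "nat \<Rightarrow> nat \<Rightarrow> 'a pair_pre_digraph \<Rightarrow> bool" where
  "r_chi_graph r \<chi> G \<longleftrightarrow> pair_graph G \<and> regular r G \<and> chromatic_number G = \<chi>"

definition cayley_graph :: "('a, 'b) monoid_scheme \<Rightarrow> 'a set \<Rightarrow> 'a pair_pre_digraph" where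
  "cayley_graph \<Gamma> S =
     \<lparr> pverts = carrier \<Gamma>,
       parcs = {(g, h). g \<in> carrier \<Gamma> \<and> h \<in> carrier \<Gamma> \<and> inv\<^bsub>\<Gamma>\<^esub> g \<otimes>\<^bsub>\<Gamma>\<^esub> h \<in> S} \<rparr>"

text \<open>
  The connection set is not required to generate the group, so Cayley graphs may be
  disconnected. This does not affect minimum orders for a positive chromatic number: the
  component of the identity is a Cayley graph with the same degree and chromatic number.

  The group may be taken on the type of the vertices, as the group structure can be
  transported along the isomorphism.
\<close>

definition is_cayley_graph :: "'a pair_pre_digraph \<Rightarrow> bool" where
  "is_cayley_graph G \<longleftrightarrow>
     (\<exists>(\<Gamma> :: 'a monoid) S. group \<Gamma> \<and> finite (carrier \<Gamma>) \<and>
        S \<subseteq> carrier \<Gamma> \<and> \<one>\<^bsub>\<Gamma>\<^esub> \<notin> S \<and> (\<forall>s \<in> S. inv\<^bsub>\<Gamma>\<^esub> s \<in> S) \<and>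
        digraph_iso (with_proj G) (with_proj (cayley_graph \<Gamma> S)))"

text \<open>
  Every finite graph has an isomorphic copy with natural numbers as vertices, so it suffices to
  consider these. If there is no graph of the required kind, the infimum of the empty set of
  natural numbers is \<open>0\<close>; a positive value is therefore attained by some graph.
\<close>

definition min_order :: "nat \<Rightarrow> nat \<Rightarrow> nat" where
  "min_order r \<chi> = Inf {card (pverts G) | G :: nat pair_pre_digraph. r_chi_graph r \<chi> G}"

definition min_cayley_order :: "nat \<Rightarrow> nat \<Rightarrow> nat" where
  "min_cayley_order r \<chi> =
     Inf {card (pverts G) | G :: nat pair_pre_digraph. r_chi_graph r \<chi> G \<and> is_cayley_graph G}"

end

theory Submission
  imports Defs
begin

text \<open>
  The complement of a \<open>k\<close>-regular graph of order \<open>n = k + 1 + d\<close> is \<open>d\<close>-regular, and colour classes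
  are cliques of the complement. So it suffices to cover the complement by \<open>k - 1 = n - d - 2\<close>
  cliques. If \<open>n \<ge> 2 * d + 4\<close> (that is, \<open>n \<le> 2 * k - 2\<close>), Tutte's theorem provides a matching of
  size \<open>d + 2\<close>, except when the complement has a complete component of order \<open>d + 1\<close>, which saves
  enough by itself. If \<open>n = 2 * d + 3\<close>, parity forces \<open>d\<close> to be even, and one needs a triangle whose
  removal leaves a perfect matching. For large \<open>d\<close> there is a triangle; if removing it leaves no
  perfect matching, the complement is very restricted and a better triangle can be chosen. The
  upper bounds come from the prism over the complete graph on \<open>k\<close> vertices and, for \<open>k = 4\<close>, from the
  complement of the 7-cycle.
\<close>

section \<open>Tutte's theorem\<close>

text \<open>The number of colours dictates both cases. With \<open>n = 2 * d + 4 + t\<close>, a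
  matching of \<open>d + 2\<close> edges and \<open>t\<close> single vertices make
  \<open>d + 2 + t = k - 1\<close> cliques. With \<open>n = 2 * d + 3\<close> only
  \<open>d + 1\<close> cliques are allowed, while pairs alone would need \<open>d + 2\<close>; one
  triangle and \<open>d\<close> pairs are exactly enough. The obstacle is that the complement has
  about twice as many vertices as its degree, which is where barriers to perfect matchings do occur.
  They have two shapes: almost bipartite, with an independent set of \<open>d + 1\<close> vertices,
  or two almost complete pieces joined only through the triangle. Each shape tells where to look for
  a better triangle: one with two vertices on the dense side of the independent set and one inside
  it, or one inside the larger piece. A barrier for the new triangle again has one of these shapes,
  and is either incompatible with the old one or reduces the first shape to the second. The
  exceptional \<open>k\<close> come from parity: \<open>n = 2 * k - 1\<close> makes
  \<open>d = k - 2\<close> even, and beyond the listed values this means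
  \<open>d \<ge> 12\<close>.\<close>

lemma hall:
  assumes "finite I" "\<And>i. i \<in> I \<Longrightarrow> finite (N i)"
    and "\<And>J. J \<subseteq> I \<Longrightarrow> card J \<le> card (\<Union> (N ` J))"
  shows "\<exists>f. inj_on f I \<and> (\<forall>i \<in> I. f i \<in> N i)"
  using assms
proof (induction "card I" arbitrary: I N rule: less_induct)
  case less
  note fin = less.prems(1,2) and cond = less.prems(3)
  show ?case
  proof (cases "I = {}")
    case False
    then obtain i where i: "i \<in> I" by auto
    \<comment> \<open>If every proper nonempty subfamily has an element to spare, giving
      \<open>y\<close> to \<open>i\<close> costs each of them at most that one. Otherwise a tight
      \<open>J\<close> is served from its own neighbourhood, and the remaining indices keep the
      condition because \<open>J \<union> L\<close> satisfies it and \<open>J\<close> contributes no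
      surplus.\<close>
    show ?thesis
    proof (cases "\<forall>J \<subset> I. J \<noteq> {} \<longrightarrow> card J < card (\<Union> (N ` J))")
      case True
      have "card {i} \<le> card (\<Union> (N ` {i}))"
        using cond i by blast
      then have "N i \<noteq> {}"
        by auto
      then obtain y where y: "y \<in> N i" by auto
      have "\<exists>f. inj_on f (I - {i}) \<and> (\<forall>j \<in> I - {i}. f j \<in> N j - {y})"
      proof (rule less.hyps)
        show "card (I - {i}) < card I"
          using fin(1) i by (rule card_Diff1_less)
        show "finite (I - {i})"
          using fin(1) by simp
        show "finite (N j - {y})" if "j \<in> I - {i}" for j
          using fin(2) that by simp
        show "card J \<le> card (\<Union> ((\<lambda>j. N j - {y}) ` J))" if J: "J \<subseteq> I - {i}" for J
        proof (cases "J = {}")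
          case False
          then have "card J < card (\<Union> (N ` J))"
            using True J i by blast
          moreover have "\<Union> ((\<lambda>j. N j - {y}) ` J) = \<Union> (N ` J) - {y}"
            by auto
          ultimately show ?thesis
            by (auto simp: card_Diff_singleton_if)
        qed simp
      qed
      then obtain f where f: "inj_on f (I - {i})" "\<forall>j \<in> I - {i}. f j \<in> N j - {y}" by blast
      have "inj_on (f(i := y)) I"
        using f by (auto simp: inj_on_def)
      moreover have "\<forall>j \<in> I. (f(i := y)) j \<in> N j"
        using f y by auto
      ultimately show ?thesis by blast
    next
      case False
      then obtain J where J: "J \<subset> I" "J \<noteq> {}" "card (\<Union> (N ` J)) \<le> card J"
        by (auto simp: not_less)
      have finJ: "finite J" and finI: "finite I"
        using J(1) fin(1) finite_subset by auto
      have "\<exists>f. inj_on f J \<and> (\<forall>j \<in> J. f j \<in> N j)"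
      proof (rule less.hyps)
        show "card J < card I"
          using J(1) finI by (rule psubset_card_mono[rotated])
        show "finite J" by (rule finJ)
        show "finite (N j)" if "j \<in> J" for j
          using fin(2) that J(1) by blast
        show "card L \<le> card (\<Union> (N ` L))" if "L \<subseteq> J" for L
          using cond that J(1) by blast
      qed
      then obtain f where f: "inj_on f J" "\<forall>j \<in> J. f j \<in> N j" by blast
      have "\<exists>g. inj_on g (I - J) \<and> (\<forall>j \<in> I - J. g j \<in> N j - \<Union> (N ` J))"
      proof (rule less.hyps)
        show "card (I - J) < card I"
          using J finI by (intro psubset_card_mono) auto
        show "finite (I - J)"
          using finI by simp
        show "finite (N j - \<Union> (N ` J))" if "j \<in> I - J" for j
          using fin(2) that by simp
        show "card L \<le> card (\<Union> ((\<lambda>j. N j - \<Union> (N ` J)) ` L))" if L: "L \<subseteq> I - J" for L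
        proof -
          have finL: "finite L"
            using L finI finite_subset by blast
          have "card J + card L = card (J \<union> L)"
            using L finJ finL by (intro card_Un_disjoint[symmetric]) auto
          also have "\<dots> \<le> card (\<Union> (N ` (J \<union> L)))"
            using L J(1) by (intro cond) auto
          also have "\<Union> (N ` (J \<union> L)) = \<Union> (N ` J) \<union> \<Union> ((\<lambda>j. N j - \<Union> (N ` J)) ` L)"
            by auto
          also have "card \<dots> \<le> card (\<Union> (N ` J)) + card (\<Union> ((\<lambda>j. N j - \<Union> (N ` J)) ` L))"
            by (rule card_Un_le)
          finally show ?thesis
            using J(3) by linarith
        qed
      qed
      then obtain g where g: "inj_on g (I - J)" "\<forall>j \<in> I - J. g j \<in> N j - \<Union> (N ` J)" by blast
      let ?h = "\<lambda>j. if j \<in> J then f j else g j"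
      have "f a \<noteq> g b" if "a \<in> J" "b \<in> I - J" for a b
      proof -
        have "f a \<in> \<Union> (N ` J)" "g b \<notin> \<Union> (N ` J)"
          using f(2) g(2) that by auto
        then show ?thesis by metis
      qed
      then have "inj_on ?h I"
        using f(1) g(1) unfolding inj_on_def by (metis DiffI)
      moreover have "\<forall>j \<in> I. ?h j \<in> N j"
        using f g by auto
      ultimately show ?thesis by blast
    qed
  qed simp
qed

text \<open>A perfect matching of a vertex set, built edge by edge. No set of edges has to be named,
  and finiteness of the vertex set follows by induction.\<close>

inductive matchable :: "('a \<Rightarrow> 'a \<Rightarrow> bool) \<Rightarrow> 'a set \<Rightarrow> bool" for E where
  empty: "matchable E {}"
| insert: "\<lbrakk>matchable E A; x \<notin> A; y \<notin> A; x \<noteq> y; E x y\<rbrakk> \<Longrightarrow> matchable E (insert x (insert y A))"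

lemma matchable_Un:
  assumes "matchable E A" "matchable E B" "A \<inter> B = {}"
  shows "matchable E (A \<union> B)"
  using assms
proof (induction rule: matchable.induct)
  case (insert A x y)
  then have "matchable E (insert x (insert y (A \<union> B)))"
    by (intro matchable.insert) auto
  then show ?case by simp
qed simp

lemma matchable_UN:
  assumes "finite I" "\<And>i. i \<in> I \<Longrightarrow> matchable E (A i)"
    and "\<And>i j. i \<in> I \<Longrightarrow> j \<in> I \<Longrightarrow> i \<noteq> j \<Longrightarrow> A i \<inter> A j = {}"
  shows "matchable E (\<Union> (A ` I))"
  using assms
proof (induction rule: finite_induct)
  case (insert i I)
  have "matchable E (A i \<union> \<Union> (A ` I))"
  proof (rule matchable_Un)
    show "A i \<inter> \<Union> (A ` I) = {}"
      using insert by fastforce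
  qed (use insert in auto)
  then show ?case by simp
qed (simp add: matchable.empty)

text \<open>
  The parts need not be connected, nor cover the complement of \<open>S\<close>; this weaker form of
  ``odd components'' avoids any reasoning about connectivity.
\<close>

definition odd_parts :: "('a \<Rightarrow> 'a \<Rightarrow> bool) \<Rightarrow> 'a set \<Rightarrow> 'a set \<Rightarrow> 'a set set \<Rightarrow> bool" where
  "odd_parts E V S F \<longleftrightarrow> S \<subseteq> V \<and> disjoint F \<and>
     (\<forall>C \<in> F. C \<subseteq> V - S \<and> odd (card C) \<and> (\<forall>x \<in> C. \<forall>y \<in> V. E x y \<longrightarrow> y \<in> C \<union> S))"

lemma odd_partsD:
  assumes "odd_parts E V S F" "C \<in> F"
  shows "C \<subseteq> V" "C \<inter> S = {}" "odd (card C)"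
    and "x \<in> C \<Longrightarrow> y \<in> V \<Longrightarrow> E x y \<Longrightarrow> y \<notin> S \<Longrightarrow> y \<in> C"
  using assms unfolding odd_parts_def by blast+

lemma odd_parts_subset:
  assumes "odd_parts E V S F"
  shows "S \<subseteq> V" "\<Union>F \<subseteq> V - S"
  using assms unfolding odd_parts_def by auto

lemma odd_parts_disjoint:
  assumes "odd_parts E V S F" "C \<in> F" "D \<in> F" "C \<noteq> D"
  shows "C \<inter> D = {}"
  using assms unfolding odd_parts_def pairwise_def disjnt_def by blast

lemma odd_parts_finite:
  assumes "finite V" "odd_parts E V S F"
  shows "finite F" "finite S" "\<And>C. C \<in> F \<Longrightarrow> finite C"
proof -
  have "F \<subseteq> Pow V" "S \<subseteq> V"
    using assms(2) unfolding odd_parts_def by auto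
  then show "finite F" "finite S" "\<And>C. C \<in> F \<Longrightarrow> finite C"
    using assms(1) by (auto intro: finite_subset)
qed

lemma even_sum_odd_iff:
  assumes "finite F" "\<And>C. C \<in> F \<Longrightarrow> odd (f C :: nat)"
  shows "even (sum f F) \<longleftrightarrow> even (card F)"
  using assms by (induction rule: finite_induct) auto

lemma odd_parts_card:
  assumes "finite V" "odd_parts E V S F"
  shows "card V = card S + sum card F + card (V - S - \<Union>F)"
proof -
  note fin = odd_parts_finite[OF assms]
  have sub: "\<Union>F \<subseteq> V - S" "S \<subseteq> V"
    using assms(2) unfolding odd_parts_def by auto
  have "sum card F = card (\<Union>F)"
    using assms fin by (intro card_Union_disjoint[symmetric]) (auto simp: odd_parts_def)
  then have "card (V - S) = sum card F + card (V - S - \<Union>F)"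
    using card_Diff_subset[of "\<Union>F" "V - S"] card_mono[of "V - S" "\<Union>F"] sub assms(1)
    by (simp add: finite_subset)
  then show ?thesis
    using card_Diff_subset[of S V] card_mono[of V S] sub assms(1) fin(2) by simp
qed

text \<open>By symmetry, an edge from the leftover vertices into a part would also leave that part.
  So the leftover set behaves like a further part, whatever its parity.\<close>

lemma odd_parts_rest_closed:
  assumes "symp E" "odd_parts E V S F" "x \<in> V - S - \<Union>F" "y \<in> V" "E x y" "y \<notin> S"
  shows "y \<in> V - S - \<Union>F"
proof -
  have "y \<notin> \<Union>F"
    using assms odd_partsD(4)[OF assms(2), of _ y x] by (auto dest: sympD)
  then show ?thesis
    using assms by auto
qed

lemma odd_parts_insert_rest:
  assumes "symp E" "odd_parts E V S F" "odd (card (V - S - \<Union>F))"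
  shows "odd_parts E V S (insert (V - S - \<Union>F) F)" "V - S - \<Union>F \<notin> F"
proof -
  have "disjoint (insert (V - S - \<Union>F) F)"
    using assms(2) unfolding odd_parts_def by (auto simp: pairwise_insert disjnt_def)
  then show "odd_parts E V S (insert (V - S - \<Union>F) F)"
    using assms(2,3) odd_parts_rest_closed[OF assms(1,2)] unfolding odd_parts_def
    by blast
  show "V - S - \<Union>F \<notin> F"
  proof
    assume "V - S - \<Union>F \<in> F"
    then have "V - S - \<Union>F = {}" by blast
    then show False using assms(3) by (metis card.empty even_zero)
  qed
qed

text \<open>Modulo 2, \<open>card V\<close> is the sum of \<open>card S\<close>,
  \<open>card F\<close> and the number of leftover vertices. For even \<open>card V\<close>, either
  the leftover set is odd and serves as one more part, or \<open>card F\<close> and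
  \<open>card S\<close> have equal parity and a surplus of one is already a surplus of two.\<close>

lemma odd_parts_saturate:
  assumes "finite V" "symp E" "odd_parts E V S F" "even (card V)" "card S < card F"
  obtains F' where "odd_parts E V S F'" "card S + 2 \<le> card F'"
proof -
  let ?R = "V - S - \<Union>F"
  note fin = odd_parts_finite[OF assms(1,3)]
  have par: "even (card S + card F + card ?R)"
    using odd_parts_card[OF assms(1,3)] even_sum_odd_iff[OF fin(1), of card]
      odd_partsD(3)[OF assms(3)] assms(4) by auto
  show ?thesis
  proof (cases "odd (card ?R)")
    case True
    have "card (insert ?R F) = Suc (card F)"
      using odd_parts_insert_rest(2)[OF assms(2,3) True] fin(1) by (rule card_insert_disjoint[rotated])
    then show ?thesis
      using that[OF odd_parts_insert_rest(1)[OF assms(2,3) True]] assms(5) by simp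
  next
    case False
    then have "card F \<noteq> card S + 1"
      using par by auto
    then show ?thesis
      using that[OF assms(3)] assms(5) by simp
  qed
qed

text \<open>
  Anderson's proof: for a largest tight set \<open>S\<close> with parts \<open>F\<close>, every part minus any one of its
  vertices inherits the condition, and Hall's theorem matches the parts with \<open>S\<close>.
\<close>

theorem tutte:
  assumes "finite V" "symp E"
    and "\<And>S F. odd_parts E V S F \<Longrightarrow> card F \<le> card S"
  shows "matchable E V"
  using assms(1,3)
proof (induction "card V" arbitrary: V rule: less_induct)
  case less
  note finV = less.prems(1) and cond = less.prems(2)
  define tight where "tight S \<longleftrightarrow> (\<exists>F. odd_parts E V S F \<and> card F = card S)" for S
  have "tight {}"
    unfolding tight_def odd_parts_def by (rule exI[of _ "{}"]) (simp add: pairwise_def)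
  moreover have "card S < Suc (card V)" if "tight S" for S
    using that finV unfolding tight_def odd_parts_def by (auto simp: less_Suc_eq_le intro: card_mono)
  ultimately obtain S where S: "tight S" "\<And>S'. tight S' \<Longrightarrow> card S' \<le> card S"
    using ex_has_greatest_nat[of tight "{}" card "Suc (card V)"] by auto
  then obtain F where F: "odd_parts E V S F" "card F = card S"
    unfolding tight_def by auto
  note fin = odd_parts_finite[OF finV F(1)]
  have no_larger: "card S' \<le> card S" if "odd_parts E V S' F'" "card S' \<le> card F'" for S' F'
  proof -
    have "tight S'"
      using that cond[OF that(1)] unfolding tight_def by (intro exI[of _ F']) simp
    then show ?thesis by (rule S(2))
  qed
  have even_V: "even (card V)"
  proof (rule ccontr)
    assume odd: "odd (card V)"
    have "odd_parts E V {} {V}"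
      using odd unfolding odd_parts_def by simp
    then show False
      using cond by fastforce
  qed
  let ?R = "V - S - \<Union>F"
  have even_R: "even (card ?R)"
    using odd_parts_card[OF finV F(1)] even_sum_odd_iff[OF fin(1), of card]
      odd_partsD(3)[OF F(1)] even_V F(2) by auto
  \<comment> \<open>Moving a leftover vertex into \<open>S\<close> makes the other leftover vertices
    an odd part, so both sides grow by one and a larger tight set arises.\<close>
  have R_empty: "?R = {}"
  proof (rule ccontr)
    assume "?R \<noteq> {}"
    then obtain x where x: "x \<in> ?R" by blast
    let ?C = "?R - {x}"
    have "odd (card ?C)"
      using even_R x finV by (metis card_Suc_Diff1 even_Suc finite_Diff)
    moreover have "?C \<notin> F"
    proof
      assume "?C \<in> F"
      then have "?C = {}" by blast
      then show False using \<open>odd (card ?C)\<close> by (metis card.empty even_zero)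
    qed
    moreover have "disjoint (insert ?C F)"
      using F(1) unfolding odd_parts_def by (auto simp: pairwise_insert disjnt_def)
    ultimately have "odd_parts E V (insert x S) (insert ?C F)"
      using F(1) x odd_parts_rest_closed[OF assms(2) F(1)] unfolding odd_parts_def
      by (intro conjI ballI) blast+
    moreover have "card (insert ?C F) = Suc (card F)"
      using \<open>?C \<notin> F\<close> fin(1) by simp
    moreover have "card (insert x S) = Suc (card S)"
      using x fin(2) by simp
    ultimately show False
      using no_larger F(2) by fastforce
  qed
  have part_minus: "matchable E (C - {x})" if C: "C \<in> F" and x: "x \<in> C" for C x
  proof (rule less.hyps)
    have "C - {x} \<subset> V"
      using x odd_partsD(1)[OF F(1) C] by blast
    then show "card (C - {x}) < card V" "finite (C - {x})"
      using finV by (auto intro: psubset_card_mono fin(3)[OF C])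
    show "card F1 \<le> card S1" if S1: "odd_parts E (C - {x}) S1 F1" for S1 F1
    proof (rule ccontr)
      assume neg: "\<not> card F1 \<le> card S1"
      have finC: "finite (C - {x})"
        using fin(3)[OF C] by simp
      moreover have "even (card (C - {x}))"
        using odd_partsD(3)[OF F(1) C] x fin(3)[OF C] by (metis card_Suc_Diff1 even_Suc)
      ultimately obtain F2 where F2: "odd_parts E (C - {x}) S1 F2" "card S1 + 2 \<le> card F2"
        using odd_parts_saturate[OF _ assms(2) S1] neg by (metis not_le)
      note fin2 = odd_parts_finite[OF finC F2(1)]
      \<comment> \<open>The surplus of two inside \<open>C - {x}\<close> is what makes this work:
        the new barrier gains \<open>card S1 + 1\<close>, the parts lose \<open>C\<close> but gain
        at least \<open>card S1 + 2\<close>. The result is at least tight and strictly larger than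
        \<open>S\<close>.\<close>
      let ?S = "S \<union> insert x S1" and ?F = "(F - {C}) \<union> F2"
      have sub: "S1 \<subseteq> C - {x}" "D \<subseteq> C - {x}" if "D \<in> F2" for D
        using F2(1) that unfolding odd_parts_def by auto
      have S1C: "S1 \<subseteq> C - {x}"
        using F2(1) unfolding odd_parts_def by auto
      have other: "D \<inter> C = {}" if "D \<in> F - {C}" for D
        using odd_parts_disjoint[OF F(1) _ C, of D] that by blast
      have F2_ne: "D \<noteq> {}" if "D \<in> F2" for D
        using odd_partsD(3)[OF F2(1) that] by auto
      have dis: "disjoint ?F"
      proof -
        have "disjoint (F - {C})"
          using F(1) unfolding odd_parts_def by (auto intro: pairwise_subset)
        moreover have "disjoint F2"
          using F2(1) unfolding odd_parts_def by simp
        moreover have "D \<inter> D' = {}" if "D \<in> F - {C}" "D' \<in> F2" for D D'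
          using other[OF that(1)] sub(2)[OF that(2)] by blast
        ultimately show ?thesis
          unfolding pairwise_def disjnt_def by (metis Int_commute Un_iff)
      qed
      have "odd_parts E V ?S ?F"
        unfolding odd_parts_def
      proof (intro conjI dis ballI impI)
        show "?S \<subseteq> V"
          using F(1) S1C x odd_partsD(1)[OF F(1) C] unfolding odd_parts_def by blast
        fix D assume D: "D \<in> ?F"
        have "D \<subseteq> V - ?S \<and> odd (card D) \<and> (\<forall>y \<in> D. \<forall>z \<in> V. E y z \<longrightarrow> z \<in> D \<union> ?S)"
        proof (cases "D \<in> F2")
          case True
          have "D \<inter> S = {}" "D \<subseteq> V"
            using odd_partsD(1,2)[OF F(1) C] sub(2)[OF True] by auto
          moreover have "z \<in> D \<union> ?S" if "y \<in> D" "z \<in> V" "E y z" for y z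
            using odd_partsD(4)[OF F(1) C, of y z] odd_partsD(4)[OF F2(1) True, of y z]
              sub(2)[OF True] that by blast
          ultimately show ?thesis
            using odd_partsD(2,3)[OF F2(1) True] sub(2)[OF True] by blast
        next
          case False
          then have D: "D \<in> F - {C}" using D by simp
          then have "D \<in> F" by simp
          then show ?thesis
            using odd_partsD[OF F(1), of D] other[OF D] S1C x by blast
        qed
        then show "D \<subseteq> V - ?S" "odd (card D)"
          and "\<And>y z. y \<in> D \<Longrightarrow> z \<in> V \<Longrightarrow> E y z \<Longrightarrow> z \<in> D \<union> ?S"
          by blast+
      qed
      moreover have card_S: "card ?S = card S + Suc (card S1)"
      proof -
        have "card (insert x S1) = Suc (card S1)"
          using S1C fin2(2) by (intro card_insert_disjoint) auto
        moreover have "S \<inter> insert x S1 = {}"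
          using S1C x odd_partsD(2)[OF F(1) C] by auto
        ultimately show ?thesis
          using fin(2) fin2(2) card_Un_disjoint[of S "insert x S1"] by simp
      qed
      moreover have "card ?F = card F - 1 + card F2"
      proof -
        have "(F - {C}) \<inter> F2 = {}"
          using other sub(2) F2_ne by fastforce
        then show ?thesis
          using fin(1) fin2(1) C card_Un_disjoint[of "F - {C}" F2] by simp
      qed
      moreover have "card F \<ge> 1"
        using C fin(1) by (auto simp: Suc_le_eq card_gt_0_iff)
      ultimately have "odd_parts E V ?S ?F \<and> card ?S \<le> card ?F \<and> card S < card ?S"
        using F2(2) F(2) by linarith
      then show False
        using no_larger not_le by blast
    qed
  qed
  define N where "N C = {s \<in> S. \<exists>c \<in> C. E c s}" for C
  have "\<exists>f. inj_on f F \<and> (\<forall>C \<in> F. f C \<in> N C)"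
  proof (rule hall)
    show "finite (N C)" if "C \<in> F" for C
      using fin(2) unfolding N_def by simp
    \<comment> \<open>The parts in \<open>J\<close> have outside neighbours only in the
      neighbourhood of \<open>J\<close>, so that neighbourhood is itself a barrier with parts
      \<open>J\<close>; the hypothesis on barriers is Hall's condition here.\<close>
    show "card J \<le> card (\<Union> (N ` J))" if J: "J \<subseteq> F" for J
    proof (rule cond)
      have NS: "\<Union> (N ` J) \<subseteq> S" "S \<subseteq> V"
        using F(1) unfolding N_def odd_parts_def by auto
      have "disjoint J"
        using F(1) J unfolding odd_parts_def by (auto intro: pairwise_subset)
      moreover have "C \<subseteq> V - \<Union> (N ` J) \<and> odd (card C) \<and>
          (\<forall>x \<in> C. \<forall>y \<in> V. E x y \<longrightarrow> y \<in> C \<union> \<Union> (N ` J))" if C: "C \<in> J" for C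
      proof -
        have "C \<in> F" using J C by blast
        note CF = odd_partsD[OF F(1) this]
        have "y \<in> C \<union> N C" if "x \<in> C" "y \<in> V" "E x y" for x y
          using CF(4)[OF that] that unfolding N_def by blast
        moreover have "N C \<subseteq> \<Union> (N ` J)"
          using C by blast
        moreover have "C \<subseteq> V - \<Union> (N ` J)"
          using CF(1,2) NS(1) by (metis Diff_Diff_Int Diff_mono Diff_triv subset_refl)
        ultimately show ?thesis
          using CF(3) by (meson UnE UnI1 UnI2 subsetD)
      qed
      ultimately show "odd_parts E V (\<Union> (N ` J)) J"
        unfolding odd_parts_def using NS by (meson subset_trans)
    qed
  qed (rule fin(1))
  then obtain f where f: "inj_on f F" "\<And>C. C \<in> F \<Longrightarrow> f C \<in> N C" by blast
  then have "f ` F = S"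
    using fin(1,2) F(2) by (intro card_subset_eq) (auto simp: card_image N_def)
  have "matchable E (insert (f C) C)" if C: "C \<in> F" for C
  proof -
    obtain c where c: "c \<in> C" "E c (f C)"
      using f(2)[OF C] unfolding N_def by blast
    have "f C \<notin> C"
      using f(2)[OF C] odd_partsD(2)[OF F(1) C] unfolding N_def by blast
    then have "matchable E (insert c (insert (f C) (C - {c})))"
      using c by (intro matchable.insert part_minus[OF C]) auto
    moreover have "insert c (insert (f C) (C - {c})) = insert (f C) C"
      using c(1) by blast
    ultimately show ?thesis by simp
  qed
  then have "matchable E (\<Union>C \<in> F. insert (f C) C)"
  proof (rule matchable_UN[OF fin(1)])
    fix C D assume CD: "C \<in> F" "D \<in> F" "C \<noteq> D"
    then have "C \<inter> D = {}"
      using odd_parts_disjoint[OF F(1)] by blast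
    moreover have "f C \<noteq> f D"
      using CD f(1) by (auto dest: inj_onD)
    moreover have "f C \<in> S" "f D \<in> S"
      using f(2) CD unfolding N_def by auto
    ultimately show "insert (f C) C \<inter> insert (f D) D = {}"
      using odd_partsD(2)[OF F(1) CD(1)] odd_partsD(2)[OF F(1) CD(2)] by blast
  qed
  moreover have "(\<Union>C \<in> F. insert (f C) C) = f ` F \<union> \<Union>F"
    by blast
  moreover have "f ` F \<union> \<Union>F = V"
    using R_empty \<open>f ` F = S\<close> odd_parts_subset[OF F(1)] by auto
  ultimately show ?case by simp
qed

text \<open>For exact counting of vertices the parts should fill all of \<open>V - S\<close>. An odd
  leftover set becomes a part; an even one is merged into an arbitrary part, which stays odd and
  keeps the number of parts.\<close>

lemma not_matchable_odd_partition:
  assumes "finite V" "symp E" "even (card V)" "\<not> matchable E V"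
  obtains S F where "odd_parts E V S F" "card S + 2 \<le> card F" "S \<union> \<Union>F = V"
proof -
  obtain S F0 where "odd_parts E V S F0" "card S < card F0"
    using tutte[OF assms(1,2)] assms(4) by (meson not_le)
  then obtain F where F: "odd_parts E V S F" "card S + 2 \<le> card F"
    using odd_parts_saturate assms by metis
  note fin = odd_parts_finite[OF assms(1) F(1)]
  let ?R = "V - S - \<Union>F"
  show ?thesis
  proof (cases "odd (card ?R)")
    case True
    have "card (insert ?R F) = Suc (card F)"
      using odd_parts_insert_rest(2)[OF assms(2) F(1) True] fin(1) by simp
    moreover have "S \<union> \<Union>(insert ?R F) = V"
      using odd_parts_subset[OF F(1)] by auto
    ultimately show ?thesis
      using that[OF odd_parts_insert_rest(1)[OF assms(2) F(1) True]] F(2) by simp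
  next
    case False
    obtain C where C: "C \<in> F"
      using F(2) by fastforce
    let ?D = "C \<union> ?R" and ?F = "insert (C \<union> ?R) (F - {C})"
    have "card ?D = card C + card ?R"
      using C fin(3) assms(1) by (intro card_Un_disjoint) auto
    then have "odd (card ?D)"
      using False odd_partsD(3)[OF F(1) C] by simp
    moreover have "disjoint ?F"
    proof -
      have "disjoint (F - {C})"
        using F(1) unfolding odd_parts_def by (auto intro: pairwise_subset)
      moreover have "?D \<inter> C' = {}" if "C' \<in> F - {C}" for C'
        using odd_parts_disjoint[OF F(1) _ C, of C'] that by blast
      ultimately show ?thesis
        unfolding pairwise_insert disjnt_def by (metis Int_commute)
    qed
    moreover have "y \<in> ?D \<union> S" if "x \<in> ?D" "y \<in> V" "E x y" for x y
      using odd_partsD(4)[OF F(1) C, of x y] odd_parts_rest_closed[OF assms(2) F(1), of x y] that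
      by blast
    moreover have "?D \<subseteq> V - S"
      using C odd_parts_subset[OF F(1)] by auto
    moreover have "C' \<subseteq> V - S \<and> odd (card C') \<and> (\<forall>x \<in> C'. \<forall>y \<in> V. E x y \<longrightarrow> y \<in> C' \<union> S)"
      if "C' \<in> F" for C'
      using F(1) that unfolding odd_parts_def by blast
    ultimately have "odd_parts E V S ?F"
      using odd_parts_subset(1)[OF F(1)] unfolding odd_parts_def by (intro conjI ballI) blast+
    moreover have "?D \<notin> F - {C}"
    proof
      assume D: "?D \<in> F - {C}"
      then have "?D \<inter> C = {}"
        using odd_parts_disjoint[OF F(1) _ C, of ?D] by blast
      then show False
        using odd_partsD(3)[OF F(1) C] by (auto simp: Int_absorb1)
    qed
    then have "card ?F = Suc (card (F - {C}))"
      using fin(1) by (intro card_insert_disjoint) auto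
    then have "card ?F = card F"
      using card_Suc_Diff1[OF fin(1) C] by simp
    moreover have "S \<union> \<Union>?F = V"
      using C odd_parts_subset[OF F(1)] by auto
    ultimately show ?thesis
      using that F(2) by simp
  qed
qed

section \<open>Clique covers of regular graphs\<close>

text \<open>A proper colouring of the complementary relation. Classes may be empty, so
  \<open>n\<close> is an upper bound on the number of cliques.\<close>

definition clique_cover :: "('a \<Rightarrow> 'a \<Rightarrow> bool) \<Rightarrow> nat \<Rightarrow> 'a set \<Rightarrow> bool" where
  "clique_cover E n A \<longleftrightarrow>
     (\<exists>f. (\<forall>v \<in> A. f v < n) \<and> (\<forall>u \<in> A. \<forall>v \<in> A. f u = f v \<longrightarrow> u \<noteq> v \<longrightarrow> E u v))"

lemma clique_cover_Un:
  assumes "clique_cover E m A" "clique_cover E n B"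
  shows "clique_cover E (m + n) (A \<union> B)"
proof -
  obtain f where f: "\<forall>v \<in> A. f v < m" "\<forall>u \<in> A. \<forall>v \<in> A. f u = f v \<longrightarrow> u \<noteq> v \<longrightarrow> E u v"
    using assms(1) unfolding clique_cover_def by blast
  obtain g where g: "\<forall>v \<in> B. g v < n" "\<forall>u \<in> B. \<forall>v \<in> B. g u = g v \<longrightarrow> u \<noteq> v \<longrightarrow> E u v"
    using assms(2) unfolding clique_cover_def by blast
  let ?h = "\<lambda>v. if v \<in> A then f v else m + g v"
  have "?h v < m + n" if "v \<in> A \<union> B" for v
    using f(1) g(1) that by (auto simp: trans_less_add1)
  moreover have "E u v" if "u \<in> A \<union> B" "v \<in> A \<union> B" "?h u = ?h v" "u \<noteq> v" for u v
    using f g that by (auto split: if_splits)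
  ultimately show ?thesis
    unfolding clique_cover_def by (intro exI[of _ ?h]) blast
qed

lemma clique_cover_clique:
  assumes "\<And>u v. u \<in> A \<Longrightarrow> v \<in> A \<Longrightarrow> u \<noteq> v \<Longrightarrow> E u v"
  shows "clique_cover E 1 A"
  unfolding clique_cover_def using assms by (intro exI[of _ "\<lambda>_. 0"]) simp

lemma clique_cover_singletons:
  assumes "finite A"
  shows "clique_cover E (card A) A"
proof -
  obtain h where "bij_betw h A {0..<card A}"
    using ex_bij_betw_finite_nat[OF assms] by blast
  then show ?thesis
    unfolding clique_cover_def bij_betw_def inj_on_def by (intro exI[of _ h]) auto
qed

lemma clique_cover_subset:
  assumes "clique_cover E n A" "B \<subseteq> A"
    and "\<And>u v. u \<in> B \<Longrightarrow> v \<in> B \<Longrightarrow> E u v \<Longrightarrow> E' u v"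
  shows "clique_cover E' n B"
proof -
  obtain f where "\<forall>v \<in> A. f v < n" "\<forall>u \<in> A. \<forall>v \<in> A. f u = f v \<longrightarrow> u \<noteq> v \<longrightarrow> E u v"
    using assms(1) unfolding clique_cover_def by blast
  then show ?thesis
    unfolding clique_cover_def using assms(2,3) by (intro exI[of _ f]) (auto simp: subset_eq)
qed

lemma clique_cover_extend:
  assumes "clique_cover E m P" "P \<subseteq> W" "finite W"
  shows "clique_cover E (m + (card W - card P)) W"
proof -
  have "clique_cover E (m + card (W - P)) (P \<union> (W - P))"
    using assms by (intro clique_cover_Un clique_cover_singletons) auto
  moreover have "P \<union> (W - P) = W" "card (W - P) = card W - card P"
    using assms by (auto intro: card_Diff_subset finite_subset)
  ultimately show ?thesis by simp
qed

lemma clique_cover_matchable: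
  assumes "matchable E A" "symp E"
  shows "finite A \<and> clique_cover E (card A div 2) A"
  using assms
proof (induction rule: matchable.induct)
  case empty
  then show ?case by (simp add: clique_cover_def)
next
  case (insert A x y)
  have "clique_cover E 1 {x, y}"
    using insert.hyps insert.prems by (intro clique_cover_clique) (auto dest: sympD)
  then have "clique_cover E (1 + card A div 2) ({x, y} \<union> A)"
    using insert by (intro clique_cover_Un) auto
  then show ?case
    using insert by simp
qed

section \<open>Counting neighbours\<close>

definition nbh :: "('a \<Rightarrow> 'a \<Rightarrow> bool) \<Rightarrow> 'a set \<Rightarrow> 'a \<Rightarrow> 'a set" where
  "nbh E A x = {y \<in> A. E x y}"

lemma nbh_subset: "nbh E A x \<subseteq> A"
  unfolding nbh_def by auto

lemma finite_nbh [simp]: "finite A \<Longrightarrow> finite (nbh E A x)"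
  unfolding nbh_def by auto

lemma card_nbh_Un:
  assumes "finite A" "finite B" "A \<inter> B = {}"
  shows "card (nbh E (A \<union> B) x) = card (nbh E A x) + card (nbh E B x)"
proof -
  have "nbh E (A \<union> B) x = nbh E A x \<union> nbh E B x"
    unfolding nbh_def by auto
  then show ?thesis
    using assms card_Un_disjoint[of "nbh E A x" "nbh E B x"] unfolding nbh_def by auto
qed

lemma sum_card_nbh_swap:
  assumes "finite A" "finite B" "symp E"
  shows "(\<Sum>x\<in>A. card (nbh E B x)) = (\<Sum>y\<in>B. card (nbh E A y))"
proof -
  have B: "card (nbh E B x) = (\<Sum>y\<in>B. if E x y then 1 else 0)" for x
    unfolding nbh_def using assms(2) by (simp add: sum.If_cases Int_def)
  have "nbh E A y = {x \<in> A. E x y}" for y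
    using assms(3) unfolding nbh_def by (auto dest: sympD)
  then have A: "card (nbh E A y) = (\<Sum>x\<in>A. if E x y then 1 else 0)" for y
    using assms(1) by (simp add: sum.If_cases Int_def)
  show ?thesis
    unfolding A B by (rule sum.swap)
qed

text \<open>The handshake lemma: a new vertex adds its degree once for itself and once through its
  neighbours.\<close>

lemma even_sum_card_nbh:
  assumes "finite A" "symp E" "irreflp E"
  shows "even (\<Sum>x\<in>A. card (nbh E A x))"
  using assms
proof (induction rule: finite_induct)
  case (insert a A)
  have eq: "card (nbh E (insert a A) x) = card (nbh E A x) + card (nbh E {a} x)" for x
    using card_nbh_Un[of A "{a}" E x] insert by simp
  have "nbh E {a} a = {}"
    using insert.prems unfolding nbh_def by (auto dest: irreflpD)
  then have "(\<Sum>x\<in>insert a A. card (nbh E (insert a A) x)) =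
      card (nbh E A a) + (\<Sum>x\<in>A. card (nbh E A x)) + (\<Sum>x\<in>A. card (nbh E {a} x))"
    using insert.hyps by (simp add: eq sum.distrib)
  also have "(\<Sum>x\<in>A. card (nbh E {a} x)) = card (nbh E A a)"
    using sum_card_nbh_swap[of A "{a}" E] insert by simp
  finally show ?case
    using insert by simp
qed simp

text \<open>Two cliques are saved either by a triangle or by two disjoint edges, and minimum degree
  two provides one of these. It serves for what remains beside a complete component.\<close>

lemma clique_cover_card_minus_2:
  assumes "finite W" "W \<noteq> {}" "symp E" "irreflp E" "\<And>x. x \<in> W \<Longrightarrow> 2 \<le> card (nbh E W x)"
  shows "clique_cover E (card W - 2) W"
proof -
  have sym: "E v u" if "E u v" for u v
    using assms(3) that by (auto dest: sympD)
  have irr: "\<not> E u u" for u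
    using assms(4) by (auto dest: irreflpD)
  obtain x where x: "x \<in> W"
    using assms(2) by auto
  have "\<not> card (nbh E W x) \<le> Suc 0"
    using assms(5)[OF x] by simp
  then obtain y z where yz: "y \<in> nbh E W x" "z \<in> nbh E W x" "y \<noteq> z"
    using assms(1) by (auto simp: card_le_Suc0_iff_eq)
  then have xyz: "y \<in> W" "z \<in> W" "E x y" "E x z" "x \<noteq> y" "x \<noteq> z"
    using irr unfolding nbh_def by auto
  show ?thesis
  proof (cases "E y z")
    case True
    let ?T = "{x, y, z}"
    have "clique_cover E 1 ?T"
      using xyz True sym by (intro clique_cover_clique) auto
    moreover have T: "?T \<subseteq> W" "card ?T = 3"
      using xyz x yz by auto
    ultimately have "clique_cover E (1 + (card W - 3)) W"
      using assms(1) by (metis clique_cover_extend)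
    moreover have "1 + (card W - 3) = card W - 2"
      using card_mono[OF assms(1) T(1)] T(2) by linarith
    ultimately show ?thesis by simp
  next
    case False
    have "2 \<le> card (nbh E W y)"
      using assms(5) xyz by blast
    \<comment> \<open>A further neighbour \<open>w\<close> of \<open>y\<close> cannot be
      \<open>z\<close>, so \<open>{x, z}\<close> and \<open>{y, w}\<close> are disjoint
      edges.\<close>
    then have "\<not> nbh E W y \<subseteq> {x}"
      using card_mono[of "{x}" "nbh E W y"] by auto
    then obtain w where w: "w \<in> W" "E y w" "w \<noteq> x"
      unfolding nbh_def by auto
    have ne: "w \<noteq> z" "w \<noteq> y"
      using w False irr by auto
    let ?P = "{x, z}" and ?Q = "{y, w}"
    have "clique_cover E (1 + 1) (?P \<union> ?Q)"
      using xyz w sym by (intro clique_cover_Un clique_cover_clique) auto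
    moreover have P: "?P \<union> ?Q \<subseteq> W" "card (?P \<union> ?Q) = 4"
      using xyz x yz w ne by auto
    ultimately have "clique_cover E (1 + 1 + (card W - 4)) W"
      using assms(1) by (metis clique_cover_extend)
    moreover have "1 + 1 + (card W - 4) = card W - 2"
      using card_mono[OF assms(1) P(1)] P(2) by linarith
    ultimately show ?thesis by simp
  qed
qed

text \<open>The complement graph. \<open>E\<close> lives on the whole type and may relate elements
  outside \<open>V\<close>, which is why degrees are always counted inside \<open>V\<close>.\<close>

locale regular_rel =
  fixes V :: "'a set" and E :: "'a \<Rightarrow> 'a \<Rightarrow> bool" and d :: nat
  assumes finite_V: "finite V"
    and symp_E: "symp E"
    and irreflp_E: "irreflp E"
    and card_nbh: "x \<in> V \<Longrightarrow> card (nbh E V x) = d"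
begin

lemma sym: "E x y \<Longrightarrow> E y x"
  using symp_E by (auto dest: sympD)

lemma irrefl: "\<not> E x x"
  using irreflp_E by (auto dest: irreflpD)

lemma finite_sub: "A \<subseteq> V \<Longrightarrow> finite A"
  using finite_V finite_subset by blast

lemma card_nbh_self_less:
  assumes "A \<subseteq> V" "x \<in> A"
  shows "card (nbh E A x) < card A"
proof (rule psubset_card_mono)
  show "nbh E A x \<subset> A"
    using assms(2) irrefl unfolding nbh_def by auto
qed (rule finite_sub[OF assms(1)])

lemma card_nbh_split:
  assumes "S \<subseteq> V" "x \<in> V"
  shows "card (nbh E S x) + card (nbh E (V - S) x) = d"
proof -
  have "S \<union> (V - S) = V"
    using assms(1) by auto
  then show ?thesis
    using card_nbh_Un[of S "V - S" E x] card_nbh[OF assms(2)] finite_sub assms(1) by auto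
qed

lemma card_nbh_part:
  assumes "odd_parts E V S F" "C \<in> F" "x \<in> C"
  shows "card (nbh E C x) + card (nbh E S x) = d"
proof -
  have sub: "C \<subseteq> V" "S \<subseteq> V" "C \<inter> S = {}"
    using odd_partsD(1,2)[OF assms(1,2)] odd_parts_subset[OF assms(1)] by auto
  have "nbh E V x = nbh E (C \<union> S) x"
    using sub odd_partsD(4)[OF assms(1,2,3)] unfolding nbh_def by blast
  then show ?thesis
    using card_nbh_Un[of C S E x] card_nbh[of x] finite_sub sub assms(3) by auto
qed

lemma degree_le_part:
  assumes "odd_parts E V S F" "C \<in> F"
  shows "d + 1 \<le> card C + card S"
proof -
  have "C \<noteq> {}"
    using odd_partsD(3)[OF assms] by auto
  then obtain x where x: "x \<in> C" by auto
  have "card (nbh E C x) < card C"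
    using card_nbh_self_less odd_partsD(1)[OF assms] x by blast
  moreover have "card (nbh E S x) \<le> card S"
    using finite_sub odd_parts_subset(1)[OF assms(1)] by (intro card_mono nbh_subset) auto
  ultimately show ?thesis
    using card_nbh_part[OF assms x] by linarith
qed

text \<open>
  The truncated difference makes parts with more than \<open>d\<close> vertices contribute \<open>0\<close>.
\<close>

lemma parts_degree_sum:
  assumes "odd_parts E V S F"
  shows "(\<Sum>C\<in>F. card C * (d + 1 - card C)) + (\<Sum>y\<in>S. card (nbh E S y)) \<le> d * card S"
proof -
  have S: "S \<subseteq> V"
    using odd_parts_subset[OF assms] by auto
  note fin = odd_parts_finite[OF finite_V assms]
  have "card C * (d + 1 - card C) \<le> (\<Sum>x\<in>C. card (nbh E S x))" if C: "C \<in> F" for C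
  proof -
    \<comment> \<open>At most \<open>card C - 1\<close> neighbours of \<open>x\<close> lie in
      \<open>C\<close>, and all others lie in \<open>S\<close>. Summing this counts arcs into
      \<open>S\<close>, of which there are at most \<open>d * card S\<close> minus those that start
      in \<open>S\<close>.\<close>
    have "d + 1 - card C \<le> card (nbh E S x)" if x: "x \<in> C" for x
      using card_nbh_part[OF assms C x] card_nbh_self_less[OF odd_partsD(1)[OF assms C] x] by linarith
    then have "(\<Sum>x\<in>C. d + 1 - card C) \<le> (\<Sum>x\<in>C. card (nbh E S x))"
      by (rule sum_mono)
    then show ?thesis by simp
  qed
  then have "(\<Sum>C\<in>F. card C * (d + 1 - card C)) \<le> (\<Sum>C\<in>F. \<Sum>x\<in>C. card (nbh E S x))"
    by (rule sum_mono)
  also have "\<dots> = (\<Sum>x\<in>\<Union>F. card (nbh E S x))"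
    using fin odd_parts_disjoint[OF assms] by (subst sum.Union_disjoint) auto
  also have "\<dots> \<le> (\<Sum>x\<in>V - S. card (nbh E S x))"
    using odd_parts_subset[OF assms] finite_V by (intro sum_mono2) auto
  also have "\<dots> = (\<Sum>y\<in>S. card (nbh E (V - S) y))"
    using finite_V fin(2) symp_E by (intro sum_card_nbh_swap) auto
  finally have "(\<Sum>C\<in>F. card C * (d + 1 - card C)) + (\<Sum>y\<in>S. card (nbh E S y)) \<le>
      (\<Sum>y\<in>S. card (nbh E S y) + card (nbh E (V - S) y))"
    by (simp add: sum.distrib)
  also have "\<dots> = d * card S"
    using card_nbh_split[OF S] S by (simp add: subset_eq)
  finally show ?thesis .
qed

text \<open>The product is concave in \<open>c\<close> and equals \<open>d\<close> at both ends
  \<open>c = 1\<close> and \<open>c = d\<close>.\<close>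

lemma mult_degree_ge:
  assumes "odd (c :: nat)" "c \<le> d"
  shows "d \<le> c * (d + 1 - c)"
proof -
  obtain a b where "c = a + 1" "d = c + b"
    using assms by (metis add.commute le_Suc_ex oddE)
  then show ?thesis by (simp add: algebra_simps)
qed

text \<open>Every part with at most \<open>d\<close> vertices absorbs at least \<open>d\<close> of
  the \<open>d * card S\<close> arcs leaving \<open>S\<close>. Hence, for positive \<open>d\<close>,
  any surplus of parts over \<open>card S\<close> consists of large ones.\<close>

lemma small_parts_bound:
  assumes "odd_parts E V S F"
  shows "d * card {C \<in> F. card C \<le> d} \<le> d * card S"
proof -
  note fin = odd_parts_finite[OF finite_V assms]
  have "d * card {C \<in> F. card C \<le> d} = (\<Sum>C\<in>{C \<in> F. card C \<le> d}. d)"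
    by simp
  also have "\<dots> \<le> (\<Sum>C\<in>{C \<in> F. card C \<le> d}. card C * (d + 1 - card C))"
    using odd_partsD(3)[OF assms] by (intro sum_mono mult_degree_ge) auto
  also have "\<dots> \<le> (\<Sum>C\<in>F. card C * (d + 1 - card C))"
    using fin(1) by (intro sum_mono2) auto
  finally show ?thesis
    using parts_degree_sum[OF assms] by linarith
qed

text \<open>With an empty barrier no edge leaves \<open>C\<close>, so \<open>C\<close> induces a
  \<open>d\<close>-regular graph of odd order.\<close>

lemma even_degree_if_odd_part:
  assumes "odd_parts E V {} F" "C \<in> F"
  shows "even d"
proof -
  have "C \<subseteq> V"
    using odd_partsD(1)[OF assms] by simp
  have "card (nbh E C x) = d" if "x \<in> C" for x
    using card_nbh_part[OF assms that] unfolding nbh_def by simp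
  then have "even (card C * d)"
    using even_sum_card_nbh[OF finite_sub[OF \<open>C \<subseteq> V\<close>] symp_E irreflp_E] by simp
  then show ?thesis
    using odd_partsD(3)[OF assms] by simp
qed

lemma even_card_mult_degree: "even (card V * d)"
  using even_sum_card_nbh[OF finite_V symp_E irreflp_E] card_nbh by simp

end

text \<open>
  The Tutte--Berge formula, by adding \<open>t\<close> universal vertices; this is why the vertex type has to
  be infinite.
\<close>

lemma clique_cover_or_odd_parts:
  fixes V :: "'a set"
  assumes "infinite (UNIV :: 'a set)" "finite V" "symp E" "irreflp E" "even (card V + t)"
  shows "clique_cover E ((card V + t) div 2) V \<or>
         (\<exists>S F. odd_parts E V S F \<and> card S + t + 2 \<le> card F)"
proof -
  have "infinite (UNIV - V)"
    using assms(1,2) by (rule Diff_infinite_finite[rotated])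
  then obtain K where K: "finite K" "card K = t" "K \<subseteq> UNIV - V"
    using infinite_arbitrarily_large by blast
  define E' where "E' x y \<longleftrightarrow> x \<noteq> y \<and> (x \<in> K \<or> y \<in> K \<or> E x y)" for x y
  have "symp E'"
    using assms(3) unfolding E'_def symp_def by blast
  have card_VK: "card (V \<union> K) = card V + t"
    using K assms(2) by (subst card_Un_disjoint) auto
  show ?thesis
  proof (cases "matchable E' (V \<union> K)")
    case True
    then have "clique_cover E' ((card V + t) div 2) (V \<union> K)"
      using clique_cover_matchable \<open>symp E'\<close> card_VK by metis
    then have "clique_cover E ((card V + t) div 2) V"
      by (rule clique_cover_subset) (use K(3) in \<open>auto simp: E'_def\<close>)
    then show ?thesis by blast
  next
    case False
    then obtain S F where SF: "odd_parts E' (V \<union> K) S F" "card S + 2 \<le> card F"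
      using not_matchable_odd_partition[of "V \<union> K" E'] \<open>symp E'\<close> K(1) assms(2,5) card_VK
      by (metis finite_UnI)
    \<comment> \<open>A universal vertex outside \<open>S\<close> is adjacent to every part and
      hence belongs to every part, but there are at least two parts and they are disjoint.\<close>
    have "K \<subseteq> S"
    proof
      fix k assume k: "k \<in> K"
      show "k \<in> S"
      proof (rule ccontr)
        assume kS: "k \<notin> S"
        have k_mem: "k \<in> C" if C: "C \<in> F" for C
        proof -
          have "C \<noteq> {}"
            using odd_partsD(3)[OF SF(1) C] by auto
          then obtain x where x: "x \<in> C" by auto
          show ?thesis
            using odd_partsD(4)[OF SF(1) C x, of k] k kS x unfolding E'_def by blast
        qed
        have "\<forall>C \<in> F. \<forall>D \<in> F. C = D"
          using k_mem odd_parts_disjoint[OF SF(1)] by blast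
        then have "card F \<le> Suc 0"
          using odd_parts_finite(1)[OF _ SF(1)] K(1) assms(2) by (simp only: card_le_Suc0_iff_eq finite_UnI)
        then show False
          using SF(2) by simp
      qed
    qed
    have C_sub: "C \<subseteq> V - (S - K)" if "C \<in> F" for C
      using odd_partsD(1,2)[OF SF(1) that] \<open>K \<subseteq> S\<close> by blast
    moreover have "y \<in> C \<union> (S - K)" if "C \<in> F" "x \<in> C" "y \<in> V" "E x y" for C x y
    proof -
      have "x \<noteq> y"
        using that(4) assms(4) by (auto dest: irreflpD)
      then show ?thesis
        using odd_partsD(4)[OF SF(1) that(1,2), of y] that K(3) unfolding E'_def by blast
    qed
    moreover have "S - K \<subseteq> V"
      using odd_parts_subset(1)[OF SF(1)] by blast
    ultimately have "odd_parts E V (S - K) F"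
      using SF(1) unfolding odd_parts_def by meson
    moreover have "card S = card (S - K) + t"
      using \<open>K \<subseteq> S\<close> K odd_parts_finite(2)[OF _ SF(1)] assms(2)
      by (metis add.commute card_Diff_subset card_mono finite_UnI le_add_diff_inverse)
    ultimately show ?thesis
      using SF(2) by (intro disjI2 exI[of _ "S - K"] exI[of _ F]) auto
  qed
qed

section \<open>Complements of order at least \<open>2 * d + 4\<close>\<close>

context regular_rel
begin

text \<open>A closed set of \<open>d + 1\<close> vertices is complete, since each of its vertices
  needs \<open>d\<close> neighbours there. It saves \<open>d\<close> cliques, and the rest, again
  \<open>d\<close>-regular, saves two more.\<close>

lemma clique_cover_clique_part:
  assumes "odd_parts E V {} F" "C \<in> F" "card C = d + 1" "2 \<le> d" "2 * d + 4 \<le> card V"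
  shows "clique_cover E (card V - d - 2) V"
proof -
  let ?W = "V - C"
  have C: "C \<subseteq> V"
    using odd_partsD(1)[OF assms(1,2)] .
  have closed: "y \<in> C" if "x \<in> C" "y \<in> V" "E x y" for x y
    using odd_partsD(4)[OF assms(1,2) that] by simp
  have "E x y" if "x \<in> C" "y \<in> C" "x \<noteq> y" for x y
  proof -
    have "nbh E C x = nbh E V x"
      using closed that C unfolding nbh_def by blast
    then have "card (nbh E C x) = d"
      using card_nbh C that by auto
    moreover have "nbh E C x \<subseteq> C - {x}" "card (C - {x}) = d"
      using irrefl assms(3) that unfolding nbh_def by auto
    ultimately have "nbh E C x = C - {x}"
      using finite_sub[OF C] by (intro card_subset_eq) auto
    then show ?thesis
      using that unfolding nbh_def by blast
  qed
  then have "clique_cover E 1 C"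
    by (rule clique_cover_clique)
  moreover have card_W: "card ?W = card V - (d + 1)"
    using C assms(3) finite_sub by (simp add: card_Diff_subset)
  moreover have "clique_cover E (card ?W - 2) ?W"
  proof (rule clique_cover_card_minus_2)
    show "?W \<noteq> {}"
    proof
      assume "?W = {}"
      then have "card V - (d + 1) = 0"
        using card_W by (metis card.empty)
      then show False
        using assms(5) by simp
    qed
    show "2 \<le> card (nbh E ?W x)" if x: "x \<in> ?W" for x
    proof -
      have "nbh E ?W x = nbh E V x"
        using closed[OF _ _ sym] x unfolding nbh_def by blast
      then show ?thesis
        using card_nbh x assms(4) by auto
    qed
  qed (use finite_V symp_E irreflp_E in auto)
  ultimately have "clique_cover E (1 + (card V - (d + 1) - 2)) (C \<union> ?W)"
    by (metis clique_cover_Un)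
  moreover have "1 + (card V - (d + 1) - 2) = card V - d - 2" "C \<union> ?W = V"
    using assms(5) C by auto
  ultimately show ?thesis by simp
qed

text \<open>A failure yields at least \<open>t + 2\<close> parts with more than \<open>d\<close>
  vertices each. Together these have at least \<open>(d + 1) * (t + 2)\<close> of the
  \<open>2 * d + 4 + t\<close> vertices, a slack of only \<open>2 - t * d\<close>, which leaves
  hardly any room for \<open>S\<close> or further parts.\<close>

lemma clique_cover_large_order:
  assumes "infinite (UNIV :: 'a set)" "1 \<le> d" "2 * d + 4 \<le> card V"
  shows "clique_cover E (card V - d - 2) V"
proof -
  define t where "t = card V - (2 * d + 4)"
  have n: "card V = 2 * d + 4 + t"
    using assms(3) unfolding t_def by simp
  have half: "(card V + t) div 2 = card V - d - 2" "even (card V + t)"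
    unfolding n by simp_all
  show ?thesis
  proof (rule ccontr)
    assume no_cover: "\<not> ?thesis"
    then obtain S F where SF: "odd_parts E V S F" "card S + t + 2 \<le> card F"
      using clique_cover_or_odd_parts[OF assms(1) finite_V symp_E irreflp_E half(2)] half(1) by auto
    note fin = odd_parts_finite[OF finite_V SF(1)]
    define Fs where "Fs = {C \<in> F. card C \<le> d}"
    define Fb where "Fb = {C \<in> F. \<not> card C \<le> d}"
    have F: "F = Fs \<union> Fb" "Fs \<inter> Fb = {}" "finite Fs" "finite Fb"
      using fin(1) unfolding Fs_def Fb_def by auto
    have card_F: "card F = card Fs + card Fb"
      using F card_Un_disjoint by metis
    have "card Fs \<le> card S"
      using small_parts_bound[OF SF(1)] assms(2) unfolding Fs_def by simp
    then have Fb_ge: "t + 2 \<le> card Fb" "t + 2 + (card S - card Fs) \<le> card Fb"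
      using SF(2) card_F by simp_all
    have sum_F: "sum card F = sum card Fs + sum card Fb"
      using F sum.union_disjoint by metis
    have n_ge: "card S + sum card F \<le> 2 * d + 4 + t"
      using odd_parts_card[OF finite_V SF(1)] n by linarith
    have Fs_sum: "card Fs \<le> sum card Fs"
    proof -
      have "(\<Sum>C\<in>Fs. 1) \<le> sum card Fs"
        using odd_partsD(3)[OF SF(1)] F(1) by (intro sum_mono) (auto simp: Suc_le_eq odd_pos)
      then show ?thesis by simp
    qed
    have Fb_sum: "m * card Fb \<le> sum card Fb" if "\<And>C. C \<in> Fb \<Longrightarrow> m \<le> card C" for m
    proof -
      have "(\<Sum>C\<in>Fb. m) \<le> sum card Fb"
        using that by (intro sum_mono) auto
      then show ?thesis by (simp add: mult.commute)
    qed
    have Fb_mult: "m * (t + 2) \<le> sum card Fb" if "\<And>C. C \<in> Fb \<Longrightarrow> m \<le> card C" for m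
      using Fb_sum[OF that] Fb_ge(1) by (meson mult_le_mono2 order_trans)
    have S_empty: "S = {}" if "card S = 0"
      using that fin(2) by simp
    obtain C0 where C0: "C0 \<in> Fb"
      using Fb_ge(1) by fastforce
    show False
    proof (cases "even d")
      case False
      \<comment> \<open>For odd \<open>d\<close> an odd part cannot have \<open>d + 1\<close>
        vertices. The stronger bound uses up all vertices, so \<open>S\<close> is empty and an odd
        part contradicts the parity of \<open>d\<close>.\<close>
      have "d + 2 \<le> card C" if "C \<in> Fb" for C
        using that odd_partsD(3)[OF SF(1), of C] False unfolding Fb_def
        by (cases "card C = d + 1") auto
      then have "(d + 2) * (t + 2) \<le> sum card Fb"
        by (rule Fb_mult)
      then have "card S = 0"
        using n_ge sum_F by (simp add: algebra_simps)
      then show False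
        using even_degree_if_odd_part[of F C0] SF(1) C0 F(1) False S_empty by auto
    next
      case True
      then have d: "2 \<le> d"
        using assms(2) by (cases "d = 1") auto
      have big: "d + 1 \<le> card C" if "C \<in> Fb" for C
        using that unfolding Fb_def by simp
      have base: "(d + 1) * (t + 2) \<le> sum card Fb"
        using big by (rule Fb_mult)
      \<comment> \<open>A small part together with \<open>S\<close> would occupy
        \<open>d + 1 \<ge> 3\<close> more vertices, which exceeds the slack.\<close>
      have "Fs = {}"
      proof (rule ccontr)
        assume "Fs \<noteq> {}"
        then obtain C where C: "C \<in> Fs" by auto
        have "card C \<le> sum card Fs"
          using C F(3) by (intro member_le_sum) auto
        then have "d + 1 \<le> sum card Fs + card S"
          using degree_le_part[OF SF(1), of C] C F(1) by auto
        then have "(d + 1) * (t + 2) + (d + 1) \<le> 2 * d + 4 + t"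
          using base n_ge sum_F by linarith
        then show False
          using d by (simp add: algebra_simps)
      qed
      have "card S = 0"
      proof (rule ccontr)
        assume "card S \<noteq> 0"
        then have "t + 3 \<le> card Fb"
          using Fb_ge(2) \<open>Fs = {}\<close> by simp
        then have "(d + 1) * (t + 3) \<le> sum card Fb"
          using Fb_sum[OF big] by (meson mult_le_mono2 order_trans)
        then show False
          using n_ge sum_F d by (simp add: algebra_simps)
      qed
      then have S: "odd_parts E V {} F"
        using SF(1) S_empty by simp
      have "\<exists>C \<in> F. card C = d + 1"
      proof (rule ccontr)
        assume none: "\<not> (\<exists>C \<in> F. card C = d + 1)"
        have "d + 3 \<le> card C" if "C \<in> Fb" for C
        proof -
          have "card C \<noteq> d + 1" "card C \<noteq> d + 2"
            using none that F(1) odd_partsD(3)[OF SF(1), of C] True by auto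
          then show ?thesis
            using big[OF that] by simp
        qed
        then have "(d + 3) * (t + 2) \<le> sum card Fb"
          by (rule Fb_mult)
        then show False
          using n_ge sum_F by (simp add: algebra_simps)
      qed
      then show False
        using clique_cover_clique_part[OF S] d assms(3) no_cover by blast
    qed
  qed
qed

end

section \<open>Complements of order \<open>2 * d + 3\<close>\<close>

definition triangle :: "('a \<Rightarrow> 'a \<Rightarrow> bool) \<Rightarrow> 'a set \<Rightarrow> bool" where
  "triangle E T \<longleftrightarrow> (\<exists>x y z. T = {x, y, z} \<and> E x y \<and> E x z \<and> E y z)"

context regular_rel
begin

lemma triangleD:
  assumes "triangle E T"
  shows "finite T" "card T = 3" "\<And>x y. x \<in> T \<Longrightarrow> y \<in> T \<Longrightarrow> x \<noteq> y \<Longrightarrow> E x y"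
proof -
  obtain x y z where T: "T = {x, y, z}" "E x y" "E x z" "E y z"
    using assms unfolding triangle_def by blast
  have "x \<noteq> y" "x \<noteq> z" "y \<noteq> z"
    using T irrefl by auto
  then show "finite T" "card T = 3"
    using T(1) by auto
  show "E a b" if "a \<in> T" "b \<in> T" "a \<noteq> b" for a b
    using that T sym by auto
qed

lemma card_nbh_triangle:
  assumes "triangle E T" "T \<subseteq> S" "S \<subseteq> V" "x \<in> T"
  shows "2 \<le> card (nbh E S x)"
proof -
  have "T - {x} \<subseteq> nbh E S x"
    using triangleD(3)[OF assms(1,4)] assms(2) unfolding nbh_def by auto
  then have "card (T - {x}) \<le> card (nbh E S x)"
    using finite_sub[OF assms(3)] by (intro card_mono) auto
  then show ?thesis
    using triangleD(1,2)[OF assms(1)] assms(4) by simp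
qed

lemma clique_cover_triangle_matching:
  assumes "card V = 2 * d + 3" "triangle E T" "T \<subseteq> V" "matchable E (V - T)"
  shows "clique_cover E (d + 1) V"
proof -
  note T = triangleD[OF assms(2)]
  have "card (V - T) = 2 * d"
    using T assms(1,3) by (simp add: card_Diff_subset)
  then have "clique_cover E d (V - T)"
    using clique_cover_matchable[OF assms(4) symp_E] by simp
  then have "clique_cover E (d + 1) ((V - T) \<union> T)"
    using T(3) by (intro clique_cover_Un clique_cover_clique) auto
  then show ?thesis
    using assms(3) by (simp add: Un_absorb2)
qed

text \<open>As \<open>c\<close> is odd and \<open>d\<close> even, \<open>c\<close> lies strictly
  between \<open>1\<close> and \<open>d\<close>. The bound is the value of the concave product at
  \<open>c = 2\<close> and at \<open>c = d - 1\<close>.\<close>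

lemma mult_degree_ge_strict:
  assumes "odd (c :: nat)" "c \<noteq> 1" "c \<le> d" "even d"
  shows "2 * (d - 1) \<le> c * (d + 1 - c)"
proof -
  have "c \<ge> 3" "c \<noteq> d"
    using assms by (auto elim: oddE)
  then obtain a b where ab: "c = a + 2" "d = c + 1 + b"
    using assms(3) by (metis Suc_eq_plus1 add.commute add_Suc le_Suc_ex le_neq_implies_less
        less_eq_Suc_le numeral_2_eq_2 numeral_3_eq_3 Suc_leD)
  then show ?thesis by (simp add: algebra_simps)
qed

text \<open>For a triangle \<open>T\<close>, both pieces are almost complete: a vertex has at most
  three neighbours in \<open>T\<close>, hence at least \<open>d - 3\<close> in its own piece. In
  \<open>A\<close>, where at most \<open>d - 2\<close> are possible, every vertex needs a neighbour
  in \<open>T\<close>.\<close>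

definition split_by :: "'a set \<Rightarrow> 'a set \<Rightarrow> 'a set \<Rightarrow> bool" where
  "split_by T A B \<longleftrightarrow> A \<union> B = V - T \<and> A \<inter> B = {} \<and> card A = d - 1 \<and> card B = d + 1 \<and>
     (\<forall>a \<in> A. \<forall>b \<in> B. \<not> E a b)"

text \<open>
  A barrier of \<open>V - T\<close> together with \<open>T\<close> has the form \<open>S \<supseteq> T\<close> with at least \<open>card S - 1\<close> odd
  parts. Since the three vertices of \<open>T\<close> waste six of the \<open>d * card S\<close> arcs leaving \<open>S\<close>, either all
  parts are singletons or some part has more than \<open>d\<close> vertices; the order then leaves room for only
  one further part.
\<close>

lemma triangle_dichotomy:
  assumes "even d" "6 \<le> d" "card V = 2 * d + 3" "triangle E T" "T \<subseteq> V" "\<not> matchable E (V - T)"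
  obtains
    (indep) S where "T \<subseteq> S" "S \<subseteq> V" "card S = d + 2" "\<And>u v. u \<in> V - S \<Longrightarrow> v \<in> V - S \<Longrightarrow> \<not> E u v"
  | (split) A B where "split_by T A B"
proof -
  note T = triangleD[OF assms(4)]
  have "card (V - T) = 2 * d"
    using T assms(3,5) by (simp add: card_Diff_subset)
  then obtain S0 F where S0: "odd_parts E (V - T) S0 F" "card S0 + 2 \<le> card F" "S0 \<union> \<Union>F = V - T"
    using not_matchable_odd_partition[of "V - T" E] assms(6) finite_V symp_E
    by (metis dvd_triv_left finite_Diff)
  define S where "S = S0 \<union> T"
  have S0_sub: "S0 \<subseteq> V - T"
    using odd_parts_subset(1)[OF S0(1)] .
  have S: "S \<subseteq> V" "T \<subseteq> S"
    using S0_sub assms(5) unfolding S_def by auto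
  have "C \<subseteq> V - S" if "C \<in> F" for C
    using odd_partsD(1,2)[OF S0(1) that] unfolding S_def by blast
  moreover have "y \<in> C \<union> S" if "C \<in> F" "x \<in> C" "y \<in> V" "E x y" for C x y
    using odd_partsD(4)[OF S0(1) that(1,2), of y] that unfolding S_def by blast
  ultimately have odd_F: "odd_parts E V S F"
    using S0(1) S(1) unfolding odd_parts_def by meson
  note fin = odd_parts_finite[OF finite_V odd_F]
  have card_S: "card S = card S0 + 3"
    using S0_sub T finite_sub[of S0] unfolding S_def by (subst card_Un_disjoint) auto
  have cover: "V - S = \<Union>F"
    using S0(3) odd_parts_subset[OF S0(1)] odd_parts_subset[OF odd_F] unfolding S_def by blast
  have total: "card S + sum card F = 2 * d + 3"
    using odd_parts_card[OF finite_V odd_F] assms(3) cover by simp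
  have six: "6 \<le> (\<Sum>y\<in>S. card (nbh E S y))"
  proof -
    have "(\<Sum>y\<in>T. 2) \<le> (\<Sum>y\<in>T. card (nbh E S y))"
      using card_nbh_triangle[OF assms(4) S(2,1)] by (intro sum_mono) auto
    also have "\<dots> \<le> (\<Sum>y\<in>S. card (nbh E S y))"
      using S fin(2) by (intro sum_mono2) auto
    finally show ?thesis
      using T by simp
  qed
  have pos: "1 \<le> card C" if "C \<in> F" for C
    using odd_partsD(3)[OF odd_F that] by (simp add: Suc_le_eq odd_pos)
  show thesis
  proof (cases "\<forall>C \<in> F. card C \<le> d")
    case True
    have single: "card C = 1" if C: "C \<in> F" for C
    proof (rule ccontr)
      assume ne: "card C \<noteq> 1"
      have "d * (card F - 1) \<le> (\<Sum>C\<in>F - {C}. card C * (d + 1 - card C))"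
      proof -
        have "(\<Sum>C\<in>F - {C}. d) \<le> (\<Sum>C\<in>F - {C}. card C * (d + 1 - card C))"
          using True odd_partsD(3)[OF odd_F] by (intro sum_mono mult_degree_ge) auto
        then show ?thesis
          using C fin(1) by (simp add: mult.commute)
      qed
      moreover have "2 * (d - 1) \<le> card C * (d + 1 - card C)"
        using mult_degree_ge_strict[OF odd_partsD(3)[OF odd_F C] ne] True C assms(1) by blast
      moreover have "(\<Sum>C\<in>F. card C * (d + 1 - card C)) =
          card C * (d + 1 - card C) + (\<Sum>C\<in>F - {C}. card C * (d + 1 - card C))"
        using fin(1) C by (rule sum.remove)
      \<comment> \<open>One part of intermediate size absorbs almost \<open>2 * d\<close> arcs, the
        at least \<open>card S0 + 1\<close> others \<open>d\<close> each. With the six arcs inside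
        \<open>T\<close> this exceeds \<open>d * (card S0 + 3)\<close> by four.\<close>
      ultimately have "2 * (d - 1) + d * (card F - 1) + 6 \<le> d * card S"
        using parts_degree_sum[OF odd_F] six by linarith
      moreover have "d * (card S0 + 1) \<le> d * (card F - 1)"
        using S0(2) by (intro mult_le_mono2) simp
      ultimately show False
        using card_S assms(2) by (simp add: algebra_simps)
    qed
    have "(\<Sum>C\<in>F. card C * (d + 1 - card C)) = d * card F"
      using single by (simp add: mult.commute)
    then have "d * card F < d * card S"
      using parts_degree_sum[OF odd_F] six by linarith
    then have "card F < card S"
      by simp
    then have "card F = card S - 1"
      using S0(2) card_S by linarith
    moreover have "sum card F = card F"
      using single by simp
    ultimately have "card S = d + 2"
      using total card_S by linarith
    moreover have "\<not> E u v" if uv: "u \<in> V - S" "v \<in> V - S" for u v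
    proof
      assume E: "E u v"
      obtain C where C: "C \<in> F" "u \<in> C"
        using uv(1) cover by auto
      have "v \<in> C"
        using odd_partsD(4)[OF odd_F C, of v] uv E by blast
      then have "u = v"
        using single[OF C(1)] C(2) by (auto simp: card_1_singleton_iff)
      then show False
        using E irrefl by simp
    qed
    ultimately show thesis
      using indep[OF S(2,1)] by blast
  next
    case False
    then obtain B where B: "B \<in> F" "d + 1 \<le> card B"
      by (auto simp: not_le)
    have "card (F - {B}) = card F - 1"
      using B fin(1) by simp
    then have card_FB: "card S0 + 1 \<le> card (F - {B})"
      using S0(2) by simp
    then have "card (F - {B}) \<noteq> 0"
      by simp
    then obtain A where A: "A \<in> F" "A \<noteq> B"
      by (metis Diff_iff card.empty ex_in_conv singletonI)
    have sum_eq: "sum card F = card B + (card A + sum card (F - {B} - {A}))"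
      using sum.remove[OF fin(1) B(1), of card] sum.remove[of "F - {B}" A card] A fin(1) by simp
    have rest_ge: "m * (card S0) \<le> sum card (F - {B} - {A})" if "\<And>C. C \<in> F \<Longrightarrow> m \<le> card C" for m
    proof -
      have "(\<Sum>C\<in>F - {B} - {A}. m) \<le> sum card (F - {B} - {A})"
        using that by (intro sum_mono) auto
      moreover have "card S0 \<le> card (F - {B} - {A})"
        using card_FB A fin(1) by simp
      ultimately show ?thesis
        by simp (metis mult.commute mult_le_mono1 order_trans)
    qed
    have part_ge: "d + 1 \<le> card C + card S" if "C \<in> F" for C
      using degree_le_part[OF odd_F that] .
    \<comment> \<open>\<open>B\<close> has at least \<open>d + 1\<close> vertices, and so do
      \<open>A\<close> and \<open>S\<close> together. Of \<open>2 * d + 3\<close> vertices this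
      leaves one, while at least \<open>card S0\<close> further parts remain. For
      \<open>card S0 = 1\<close> the further part would need \<open>d - 3 \<ge> 3\<close>
      vertices.\<close>
    have S0_le: "card S0 \<le> 1"
      using rest_ge[of 1] pos total sum_eq B(2) part_ge[OF A(1)] card_S by simp
    have "card S0 \<noteq> 1"
    proof
      assume S0_1: "card S0 = 1"
      then have "d - 3 \<le> card C" if "C \<in> F" for C
        using part_ge[OF that] card_S by simp
      then show False
        using rest_ge[of "d - 3"] total sum_eq B(2) part_ge[OF A(1)] card_S S0_1 assms(2) by simp
    qed
    then have S0_0: "card S0 = 0"
      using S0_le by linarith
    then have "S = T"
      using finite_subset[OF S0_sub] finite_V unfolding S_def by auto
    have "card A \<noteq> d - 2"
      using odd_partsD(3)[OF odd_F A(1)] assms(1,2) by auto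
    then have A_ge: "d - 1 \<le> card A"
      using part_ge[OF A(1)] card_S S0_0 by simp
    then have cards: "card A = d - 1" "card B = d + 1" "sum card (F - {B} - {A}) = 0"
      using total sum_eq B(2) card_S S0_0 assms(2) by linarith+
    have "F - {B} - {A} = {}"
    proof (rule ccontr)
      assume "F - {B} - {A} \<noteq> {}"
      then obtain C where C: "C \<in> F - {B} - {A}" by auto
      then have "card C = 0"
        using cards(3) fin(1) by simp
      then show False
        using pos[of C] C by simp
    qed
    then have "F = {A, B}"
      using A B by auto
    then have "A \<union> B = V - T"
      using cover \<open>S = T\<close> by auto
    moreover have "A \<inter> B = {}"
      using odd_parts_disjoint[OF odd_F A(1) B(1) A(2)] .
    moreover have "\<not> E a b" if "a \<in> A" "b \<in> B" for a b
      using odd_partsD(4)[OF odd_F A(1) that(1), of b] odd_partsD(1,2)[OF odd_F B(1)] that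
        \<open>A \<inter> B = {}\<close> by blast
    ultimately have "split_by T A B"
      using cards(1,2) unfolding split_by_def by blast
    then show thesis
      by (rule split)
  qed
qed

lemma split_by_card_nbh:
  assumes "split_by T A B" "card T = 3" "T \<subseteq> V"
  shows "x \<in> A \<Longrightarrow> card (nbh E A x) + card (nbh E T x) = d"
    and "x \<in> B \<Longrightarrow> card (nbh E B x) + card (nbh E T x) = d"
proof -
  have eq: "A \<union> B = V - T" "A \<inter> B = {}" and no: "\<And>a b. a \<in> A \<Longrightarrow> b \<in> B \<Longrightarrow> \<not> E a b"
    using assms(1) unfolding split_by_def by auto
  then have sub: "A \<inter> T = {}" "B \<inter> T = {}" "A \<subseteq> V" "B \<subseteq> V"
    by auto
  note fin = finite_sub[OF sub(3)] finite_sub[OF sub(4)] finite_sub[OF assms(3)]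
  have V: "V = A \<union> B \<union> T"
    using eq assms(3) by auto
  show "card (nbh E A x) + card (nbh E T x) = d" if "x \<in> A"
  proof -
    have "nbh E V x = nbh E (A \<union> T) x"
      using no[OF that] V unfolding nbh_def by auto
    then show ?thesis
      using card_nbh_Un[of A T E x] card_nbh[of x] fin sub that by auto
  qed
  show "card (nbh E B x) + card (nbh E T x) = d" if "x \<in> B"
  proof -
    have "nbh E V x = nbh E (B \<union> T) x"
      using no[OF _ that] sym V unfolding nbh_def by auto
    then show ?thesis
      using card_nbh_Un[of B T E x] card_nbh[of x] fin sub that by auto
  qed
qed

text \<open>An independent set through \<open>x\<close> avoids the neighbours of \<open>x\<close>;
  \<open>x\<close> itself need not lie in \<open>P\<close>.\<close>

lemma independent_inter_bound:
  assumes "P \<subseteq> V" "\<And>u v. u \<in> I \<Longrightarrow> v \<in> I \<Longrightarrow> \<not> E u v" "x \<in> I"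
  shows "card (I \<inter> P) + card (nbh E P x) \<le> card P"
proof -
  have "I \<inter> P \<subseteq> P - nbh E P x"
    using assms(2,3) unfolding nbh_def by blast
  then have "card (I \<inter> P) \<le> card (P - nbh E P x)"
    using finite_sub[OF assms(1)] by (intro card_mono) auto
  also have "\<dots> = card P - card (nbh E P x)"
    by (intro card_Diff_subset finite_nbh nbh_subset finite_sub[OF assms(1)])
  finally show ?thesis
    using card_mono[OF finite_sub[OF assms(1)] nbh_subset[of E P x]] by linarith
qed

text \<open>The bound is \<open>2 + 4 + 3\<close>, for \<open>A\<close>, \<open>B\<close> and
  \<open>T\<close>: a vertex has at least \<open>d - 3\<close> neighbours in its own piece, which
  has \<open>d - 1\<close> or \<open>d + 1\<close> vertices.\<close>

lemma split_by_independent_card: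
  assumes "split_by T A B" "card T = 3" "T \<subseteq> V" "3 \<le> d"
    and "I \<subseteq> V" "\<And>u v. u \<in> I \<Longrightarrow> v \<in> I \<Longrightarrow> \<not> E u v"
  shows "card I \<le> 9"
proof -
  have AB: "A \<union> B = V - T" "card A = d - 1" "card B = d + 1"
    using assms(1) unfolding split_by_def by auto
  then have sub: "A \<subseteq> V" "B \<subseteq> V"
    by auto
  have finT: "finite T"
    using finite_sub[OF assms(3)] .
  have nbh_T: "card (nbh E T x) \<le> 3" for x
    using card_mono[OF finT nbh_subset[of E T x]] assms(2) by simp
  have "card (I \<inter> A) \<le> 2"
  proof (cases "I \<inter> A = {}")
    case False
    then obtain a where a: "a \<in> I" "a \<in> A" by auto
    show ?thesis
      using independent_inter_bound[OF sub(1) assms(6) a(1)] split_by_card_nbh(1)[OF assms(1-3) a(2)]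
        nbh_T[of a] AB(2) assms(4) by linarith
  qed simp
  moreover have "card (I \<inter> B) \<le> 4"
  proof (cases "I \<inter> B = {}")
    case False
    then obtain b where b: "b \<in> I" "b \<in> B" by auto
    show ?thesis
      using independent_inter_bound[OF sub(2) assms(6) b(1)] split_by_card_nbh(2)[OF assms(1-3) b(2)]
        nbh_T[of b] AB(3) by linarith
  qed simp
  moreover have "card (I \<inter> T) \<le> 3"
    using card_mono[OF finT, of "I \<inter> T"] assms(2) by simp
  moreover have "I = (I \<inter> A) \<union> (I \<inter> B) \<union> (I \<inter> T)"
    using AB(1) assms(5) by blast
  then have "card I \<le> card (I \<inter> A) + card (I \<inter> B) + card (I \<inter> T)"
    by (metis card_Un_le add_le_mono1 order_trans)
  ultimately show ?thesis by linarith
qed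

lemma common_nbh:
  assumes "P \<subseteq> V" "card P < card (nbh E P x) + card (nbh E P y)"
  obtains w where "w \<in> P" "E x w" "E y w"
proof -
  have "nbh E P x \<inter> nbh E P y \<noteq> {}"
  proof
    assume "nbh E P x \<inter> nbh E P y = {}"
    then have "card (nbh E P x) + card (nbh E P y) = card (nbh E P x \<union> nbh E P y)"
      using finite_sub[OF assms(1)] by (intro card_Un_disjoint[symmetric]) auto
    also have "\<dots> \<le> card P"
      using finite_sub[OF assms(1)] by (intro card_mono Un_least nbh_subset)
    finally show False
      using assms(2) by simp
  qed
  then show ?thesis
    using that unfolding nbh_def by blast
qed

text \<open>The new triangle is taken inside the larger piece \<open>B\<close>, where any two
  vertices have a common neighbour. Its failure cannot produce a large independent set, as these
  have at most nine vertices, nor a second split, because \<open>A\<close> and \<open>T\<close>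
  would end up on opposite sides although every vertex of \<open>A\<close> has a neighbour in
  \<open>T\<close>.\<close>

lemma clique_cover_split:
  assumes "even d" "12 \<le> d" "card V = 2 * d + 3" "triangle E T" "T \<subseteq> V" "split_by T A B"
  shows "clique_cover E (d + 1) V"
proof -
  note T = triangleD[OF assms(4)]
  note nb = split_by_card_nbh[OF assms(6) T(2) assms(5)]
  have AB: "A \<union> B = V - T" "A \<inter> B = {}" "card A = d - 1" "card B = d + 1"
    and no: "\<And>a b. a \<in> A \<Longrightarrow> b \<in> B \<Longrightarrow> \<not> E a b"
    using assms(6) unfolding split_by_def by auto
  have B_sub: "B \<subseteq> V"
    using AB(1) by auto
  have nb_B: "d - 3 \<le> card (nbh E B b)" if "b \<in> B" for b
    using nb(2)[OF that] card_mono[OF T(1) nbh_subset[of E T b]] T(2) by simp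
  have "B \<noteq> {}"
    using AB(4) by auto
  then obtain x where x: "x \<in> B" by auto
  have "nbh E B x \<noteq> {}"
    using nb_B[OF x] assms(2) by auto
  then obtain y where y: "y \<in> B" "E x y"
    unfolding nbh_def by auto
  have "card B < card (nbh E B x) + card (nbh E B y)"
    using nb_B[OF x] nb_B[OF y(1)] AB(4) assms(2) by linarith
  then obtain z where z: "z \<in> B" "E x z" "E y z"
    by (rule common_nbh[OF B_sub])
  define T' where "T' = {x, y, z}"
  have T': "triangle E T'" "T' \<subseteq> V" "T' \<subseteq> B"
    using x y z B_sub unfolding T'_def triangle_def by auto
  note T'_card = triangleD(1,2)[OF T'(1)]
  show ?thesis
  proof (rule ccontr)
    assume "\<not> ?thesis"
    then have nm: "\<not> matchable E (V - T')"
      using clique_cover_triangle_matching[OF assms(3) T'(1,2)] by blast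
    have "6 \<le> d"
      using assms(2) by simp
    show False
      using assms(1) \<open>6 \<le> d\<close> assms(3) T'(1,2) nm
    proof (cases rule: triangle_dichotomy)
      case (indep S)
      have "card (V - S) = d + 1"
        using indep(2,3) finite_sub assms(3) by (simp add: card_Diff_subset)
      moreover have "card (V - S) \<le> 9"
        using split_by_independent_card[OF assms(6) T(2) assms(5), of "V - S"] indep(4) assms(2) by auto
      ultimately show False
        using assms(2) by simp
    next
      case (split A' B')
      have AB': "A' \<union> B' = V - T'" "A' \<inter> B' = {}" "card A' = d - 1"
        and no': "\<And>a b. a \<in> A' \<Longrightarrow> b \<in> B' \<Longrightarrow> \<not> E a b"
        using split unfolding split_by_def by auto
      note nb' = split_by_card_nbh(1)[OF split T'_card(2) T'(2)]
      \<comment> \<open>Vertices of \<open>A'\<close> need a neighbour in \<open>T'\<close>, but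
        \<open>T'\<close> lies in \<open>B\<close> and thus has no edges to
        \<open>A\<close>.\<close>
      have "A \<inter> A' = {}"
      proof (rule ccontr)
        assume "A \<inter> A' \<noteq> {}"
        then obtain a where a: "a \<in> A" "a \<in> A'" by auto
        have "card (nbh E A' a) < d - 1"
          using card_nbh_self_less[of A' a] AB' a(2) by auto
        then have "nbh E T' a \<noteq> {}"
          using nb'[OF a(2)] by auto
        then show False
          using no[OF a(1)] T'(3) unfolding nbh_def by auto
      qed
      then have A_B': "A \<subseteq> B'"
        using AB(1,2) AB'(1) T'(3) by blast
      have "card (B - T') = d - 2"
        using T' T'_card AB(4) by (simp add: card_Diff_subset)
      \<comment> \<open>\<open>A'\<close> is too large by one to fit into \<open>B - T'\<close>, so
        it meets \<open>T\<close>; being a clique that avoids \<open>T'\<close>, the whole of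
        \<open>T\<close> then lies in \<open>A'\<close>.\<close>
      then have "\<not> A' \<subseteq> B - T'"
        using AB'(3) assms(2) card_mono[of "B - T'" A'] finite_sub[OF B_sub] by auto
      then obtain t where t: "t \<in> A'" "t \<in> T"
        using AB(1) AB'(1) \<open>A \<inter> A' = {}\<close> by blast
      have T_A': "T \<subseteq> A'"
      proof
        fix s assume s: "s \<in> T"
        then have "s \<in> A' \<union> B'"
          using AB(1) AB'(1) T'(3) assms(5) by blast
        moreover have "s = t \<or> E t s"
          using T(3)[OF t(2) s] by blast
        ultimately show "s \<in> A'"
          using no'[OF t(1), of s] t(1) by auto
      qed
      have "A \<noteq> {}"
        using AB(3) assms(2) by auto
      then obtain a where a: "a \<in> A" by auto
      have "card (nbh E A a) < d - 1"
        using card_nbh_self_less[of A a] AB(1,3) a by auto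
      then have "nbh E T a \<noteq> {}"
        using nb(1)[OF a] by auto
      then show False
        using no' T_A' A_B' a sym unfolding nbh_def by blast
    qed
  qed
qed

text \<open>The independent set \<open>I\<close> sends \<open>d * (d + 1)\<close> of the
  \<open>d * (d + 2)\<close> arcs that meet \<open>S\<close>, so the degrees inside \<open>S\<close>
  add up to just \<open>d\<close> and the graph is almost bipartite. Replacing a corner of the
  triangle by a vertex of \<open>I\<close> gives a triangle across the bipartition. An independent
  set of \<open>d + 1\<close> vertices that avoids it would have to meet both sides, which is too
  costly.\<close>

lemma clique_cover_independent:
  assumes "even d" "12 \<le> d" "card V = 2 * d + 3" "triangle E T" "T \<subseteq> S" "S \<subseteq> V" "card S = d + 2"
    and ind: "\<And>u v. u \<in> V - S \<Longrightarrow> v \<in> V - S \<Longrightarrow> \<not> E u v"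
  shows "clique_cover E (d + 1) V"
proof (rule ccontr)
  assume no_cover: "\<not> ?thesis"
  define I where "I = V - S"
  have I: "I \<subseteq> V" "finite I" "card I = d + 1"
    unfolding I_def using finite_V assms(3,6,7) finite_sub by (auto simp: card_Diff_subset)
  have finS: "finite S"
    using finite_sub[OF assms(6)] .
  define a where "a u = card (nbh E S u)" for u
  have a_I: "a u + card (nbh E I u) = d" if "u \<in> V" for u
    using card_nbh_split[OF assms(6) that] unfolding a_def I_def .
  have nbh_S: "card (nbh E S i) = d" if "i \<in> I" for i
  proof -
    have "nbh E I i = {}"
      using ind that unfolding I_def nbh_def by blast
    then show ?thesis
      using a_I[of i] that I(1) unfolding a_def by auto
  qed
  have sum_a: "sum a S = d"
  proof -
    have "(\<Sum>u\<in>S. a u + card (nbh E I u)) = d * (d + 2)"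
      using a_I assms(6,7) by (simp add: subset_eq)
    moreover have "(\<Sum>u\<in>S. card (nbh E I u)) = d * (d + 1)"
      using sum_card_nbh_swap[OF finS I(2) symp_E] nbh_S I(3) by simp
    ultimately show ?thesis
      by (simp add: sum.distrib algebra_simps)
  qed
  have sum3: "a u + a v + a w \<le> d" if "{u, v, w} \<subseteq> S" "u \<noteq> v" "u \<noteq> w" "v \<noteq> w" for u v w
  proof -
    have "sum a {u, v, w} \<le> sum a S"
      using that finS by (intro sum_mono2) auto
    then show ?thesis
      using that sum_a by simp
  qed
  obtain x y z where xyz: "T = {x, y, z}" "E x y" "E x z" "E y z"
    using assms(4) unfolding triangle_def by blast
  have a_ge: "2 \<le> a u" if "u \<in> T" for u
    using card_nbh_triangle[OF assms(4-6) that] unfolding a_def .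
  have ne: "x \<noteq> y" "x \<noteq> z" "y \<noteq> z"
    using xyz irrefl by auto
  have xyS: "x \<in> S" "y \<in> S"
    using xyz(1) assms(5) by auto
  have "a x + a y + 2 \<le> d"
    using sum3[of x y z] a_ge[of z] xyz(1) ne assms(5) by auto
  \<comment> \<open>The third corner \<open>z\<close> already uses two of the \<open>d\<close> arcs
    inside \<open>S\<close>. So \<open>x\<close> and \<open>y\<close> have together at least
    \<open>2 * d - (d - 2) = d + 2\<close> neighbours in \<open>I\<close>, one more than
    \<open>card I\<close>.\<close>
  then have "card I < card (nbh E I x) + card (nbh E I y)"
    using a_I[of x] a_I[of y] xyS assms(6) I(3) by force
  then obtain w where w: "w \<in> I" "E x w" "E y w"
    using common_nbh[OF I(1)] by blast
  define T' where "T' = {x, y, w}"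
  have T': "triangle E T'" "T' \<subseteq> V"
    using xyz w xyS assms(6) I(1) unfolding T'_def triangle_def by auto
  have nm: "\<not> matchable E (V - T')"
    using clique_cover_triangle_matching[OF assms(3) T'] no_cover by blast
  have "6 \<le> d"
    using assms(2) by simp
  show False
    using assms(1) \<open>6 \<le> d\<close> assms(3) T' nm
  proof (cases rule: triangle_dichotomy)
    case (split A B)
    then show False
      using clique_cover_split[OF assms(1-3) T'] no_cover by blast
  next
    case (indep S')
    define I' where "I' = V - S'"
    have I': "finite I'" "card I' = d + 1"
      unfolding I'_def using finite_V assms(3) indep(2,3) finite_sub by (auto simp: card_Diff_subset)
    have ind': "\<not> E u v" if "u \<in> I'" "v \<in> I'" for u v
      using indep(4) that unfolding I'_def by blast
    have notin: "x \<notin> I'" "y \<notin> I'" "w \<notin> I'"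
      using indep(1) unfolding I'_def T'_def by auto
    have cards: "card (I' \<inter> S) + card (I' \<inter> I) = d + 1"
    proof -
      have "I' = (I' \<inter> S) \<union> (I' \<inter> I)" "(I' \<inter> S) \<inter> (I' \<inter> I) = {}"
        unfolding I_def I'_def by blast+
      then show ?thesis
        using I' card_Un_disjoint by (metis finite_Int)
    qed
    have "card (I' \<inter> S) \<le> card (S - {x, y})"
      using notin finS by (intro card_mono) auto
    also have "card (S - {x, y}) = d"
      using xyS ne(1) assms(7) finS by (simp add: card_Diff_subset)
    finally have "card (I' \<inter> I) \<noteq> 0"
      using cards by linarith
    then obtain i where i: "i \<in> I'" "i \<in> I"
      by (metis IntE card.empty ex_in_conv)
    \<comment> \<open>A vertex of \<open>I\<close> is adjacent to all but two vertices of
      \<open>S\<close>. Conversely, \<open>x\<close> and \<open>y\<close> use four of the arcs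
      inside \<open>S\<close>, so \<open>v\<close> keeps at least four neighbours in
      \<open>I\<close>; then \<open>I'\<close> has at most \<open>2 + (d - 3)\<close>
      vertices.\<close>
    have two: "card (I' \<inter> S) \<le> 2"
      using independent_inter_bound[OF assms(6) ind' i(1)] nbh_S[OF i(2)] assms(7) by simp
    have "card (I' \<inter> I) \<le> card (I - {w})"
      using notin I(2) by (intro card_mono) auto
    then have "card (I' \<inter> I) \<le> d"
      using w(1) I(3) by simp
    then have "card (I' \<inter> S) \<noteq> 0"
      using cards by linarith
    then obtain v where v: "v \<in> I'" "v \<in> S"
      by (metis IntE card.empty ex_in_conv)
    have "v \<noteq> x" "v \<noteq> y"
      using v(1) notin by auto
    then have "a v + 4 \<le> d"
      using sum3[of v x y] a_ge[of x] a_ge[of y] v(2) xyS ne(1) xyz(1) by auto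
    moreover have "v \<in> V"
      using v(2) assms(6) by auto
    ultimately show False
      using independent_inter_bound[OF I(1) ind' v(1)] a_I[of v] cards two I(3) by linarith
  qed
qed

text \<open>Without triangles, the neighbourhoods \<open>P\<close> and \<open>Q\<close> of two
  adjacent vertices are disjoint independent sets of size \<open>d\<close>, and only three vertices
  remain. These send equally many arcs to \<open>P\<close> and to \<open>Q\<close>, yet each is
  joined to one side only, by at least \<open>d - 2\<close> arcs; three vertices cannot be balanced
  in this way.\<close>

lemma exists_triangle:
  assumes "9 \<le> d" "card V = 2 * d + 3"
  shows "\<exists>T. triangle E T \<and> T \<subseteq> V"
proof (rule ccontr)
  assume "\<not> ?thesis"
  then have none: "\<not> (triangle E T \<and> T \<subseteq> V)" for T
    by blast
  have tri_free: "\<not> E y z" if "x \<in> V" "y \<in> V" "z \<in> V" "E x y" "E x z" for x y z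
    using that(1-5) none[of "{x, y, z}"]
    unfolding triangle_def by blast
  have "V \<noteq> {}"
    using assms(2) by auto
  then obtain u where u: "u \<in> V" by auto
  have "nbh E V u \<noteq> {}"
    using card_nbh[OF u] assms(1) by auto
  then obtain v where v: "v \<in> V" "E u v"
    unfolding nbh_def by auto
  define P where "P = nbh E V u"
  define Q where "Q = nbh E V v"
  define R where "R = V - (P \<union> Q)"
  have PQ: "P \<subseteq> V" "Q \<subseteq> V" "card P = d" "card Q = d" "P \<inter> Q = {}"
    using card_nbh u v tri_free[of u v] unfolding P_def Q_def nbh_def by auto
  note fin = finite_sub[OF PQ(1)] finite_sub[OF PQ(2)]
  have R: "R \<subseteq> V" "finite R"
    unfolding R_def using finite_V by auto
  have "card R = card V - card (P \<union> Q)"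
    unfolding R_def using PQ fin by (intro card_Diff_subset) auto
  then have card_R: "card R = 3"
    using card_Un_disjoint[OF fin PQ(5)] PQ(3,4) assms(2) by simp
  have split: "card (nbh E P x) + card (nbh E Q x) + card (nbh E R x) = d" if "x \<in> V" for x
  proof -
    have "V = (P \<union> Q) \<union> R"
      unfolding R_def using PQ by auto
    then show ?thesis
      using card_nbh[OF that] card_nbh_Un[of "P \<union> Q" R E x] card_nbh_Un[of P Q E x] fin R(2) PQ(5)
      unfolding R_def by auto
  qed
  have P_ind: "nbh E P p = {}" if "p \<in> P" for p
    using tri_free[OF u] that unfolding P_def nbh_def by blast
  have Q_ind: "nbh E Q q = {}" if "q \<in> Q" for q
    using tri_free[OF v(1)] that unfolding Q_def nbh_def by blast
  have "(\<Sum>p\<in>P. card (nbh E Q p)) + (\<Sum>p\<in>P. card (nbh E R p)) = (\<Sum>p\<in>P. d)"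
    unfolding sum.distrib[symmetric] using split P_ind PQ(1) by (intro sum.cong) fastforce+
  moreover have "(\<Sum>q\<in>Q. card (nbh E P q)) + (\<Sum>q\<in>Q. card (nbh E R q)) = (\<Sum>q\<in>Q. d)"
    unfolding sum.distrib[symmetric] using split Q_ind PQ(2) by (intro sum.cong) fastforce+
  moreover have "(\<Sum>p\<in>P. card (nbh E Q p)) = (\<Sum>q\<in>Q. card (nbh E P q))"
    using fin symp_E by (rule sum_card_nbh_swap)
  ultimately have "(\<Sum>p\<in>P. card (nbh E R p)) = (\<Sum>q\<in>Q. card (nbh E R q))"
    using PQ(3,4) by simp
  then have balance: "(\<Sum>r\<in>R. card (nbh E P r)) = (\<Sum>r\<in>R. card (nbh E Q r))"
    using sum_card_nbh_swap[OF fin(1) R(2) symp_E] sum_card_nbh_swap[OF fin(2) R(2) symp_E] by simp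
  have nbh_R: "card (nbh E R x) \<le> 3" for x
    using card_mono[OF R(2) nbh_subset[of E R x]] card_R by simp
  txt \<open>A vertex of \<open>R\<close> with neighbours in both \<open>P\<close> and \<open>Q\<close> has at most three in each.\<close>
  have one_sided: "card (nbh E P r) = 0 \<or> card (nbh E Q r) = 0" if r: "r \<in> R" for r
  proof (rule ccontr)
    assume "\<not> ?thesis"
    then have "nbh E P r \<noteq> {}" "nbh E Q r \<noteq> {}"
      by auto
    then obtain p q where pq: "p \<in> P" "E r p" "q \<in> Q" "E r q"
      unfolding nbh_def by blast
    have rV: "r \<in> V"
      using r R(1) by auto
    have bound: "card (nbh E X r) \<le> 3"
      if X: "X \<subseteq> V" "card X = d" "s \<in> V" "E r s" "card (nbh E X s) + card (nbh E R s) = d" for X s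
    proof -
      \<comment> \<open>The neighbour \<open>s\<close> of \<open>r\<close> is adjacent to at least
        \<open>d - 3\<close> of the \<open>d\<close> vertices of \<open>X\<close>, and none of these
        can be adjacent to \<open>r\<close>.\<close>
      have "\<not> card X < card (nbh E X r) + card (nbh E X s)"
      proof
        assume "card X < card (nbh E X r) + card (nbh E X s)"
        then obtain w where "w \<in> X" "E r w" "E s w"
          using common_nbh[OF X(1)] by blast
        then show False
          using tri_free[OF rV X(3), of w] X(1,4) by blast
      qed
      then show ?thesis
        using X(2,5) nbh_R[of s] by linarith
    qed
    have "card (nbh E Q r) \<le> 3"
      using bound[OF PQ(2,4) _ pq(2)] split[of p] P_ind[OF pq(1)] pq(1) PQ(1) by auto
    moreover have "card (nbh E P r) \<le> 3"
      using bound[OF PQ(1,3) _ pq(4)] split[of q] Q_ind[OF pq(3)] pq(3) PQ(2) by auto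
    moreover have "card (nbh E R r) < 3"
      using card_nbh_self_less[OF R(1) r] card_R by simp
    \<comment> \<open>At most \<open>3 + 3 + 2 = 8\<close> neighbours remain for \<open>r\<close>,
      hence the hypothesis \<open>9 \<le> d\<close>.\<close>
    ultimately show False
      using split[OF rV] assms(1) by linarith
  qed
  have range: "d \<le> card (nbh E P r) + card (nbh E Q r) + 2"
      "card (nbh E P r) \<le> d" "card (nbh E Q r) \<le> d" if r: "r \<in> R" for r
    using split[of r] R(1) card_nbh_self_less[OF R(1) r] card_R r by force+
  obtain r1 r2 r3 where r: "R = {r1, r2, r3}" "r1 \<noteq> r2" "r1 \<noteq> r3" "r2 \<noteq> r3"
    using card_R by (auto simp: card_3_iff)
  have "card (nbh E P r1) + card (nbh E P r2) + card (nbh E P r3) =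
      card (nbh E Q r1) + card (nbh E Q r2) + card (nbh E Q r3)"
    using balance r by simp
  then show False
    using one_sided[of r1] one_sided[of r2] one_sided[of r3] range[of r1] range[of r2] range[of r3]
      r(1) assms(1) by auto
qed

lemma clique_cover_even_degree:
  assumes "even d" "12 \<le> d" "card V = 2 * d + 3"
  shows "clique_cover E (d + 1) V"
proof -
  obtain T where T: "triangle E T" "T \<subseteq> V"
    using exists_triangle assms(2,3) by fastforce
  show ?thesis
  proof (cases "matchable E (V - T)")
    case True
    then show ?thesis
      by (rule clique_cover_triangle_matching[OF assms(3) T])
  next
    case False
    have "6 \<le> d"
      using assms(2) by simp
    show ?thesis
      using assms(1) \<open>6 \<le> d\<close> assms(3) T False
    proof (cases rule: triangle_dichotomy)
      case (indep S)
      then show ?thesis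
        using clique_cover_independent[OF assms T(1)] by blast
    next
      case (split A B)
      then show ?thesis
        using clique_cover_split[OF assms T] by blast
    qed
  qed
qed

end

section \<open>Cayley graphs\<close>

lemma chromatic_number_le:
  assumes "proper_colouring G m f"
  shows "chromatic_number G \<le> m"
  unfolding chromatic_number_def using assms by (intro Least_le) blast

lemma chromatic_number_eqI:
  assumes "proper_colouring G m f" "\<And>m' g. proper_colouring G m' g \<Longrightarrow> m \<le> m'"
  shows "chromatic_number G = m"
  unfolding chromatic_number_def using assms by (intro Least_equality) blast+

text \<open>The least number is attained only if some colouring exists, which the premise supplies
  with an arbitrary \<open>m\<close>.\<close>

lemma chromatic_number_colouring:
  assumes "proper_colouring G m f"
  shows "\<exists>g. proper_colouring G (chromatic_number G) g"
  unfolding chromatic_number_def by (rule LeastI_ex) (use assms in blast)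

lemma digraph_iso_refl:
  assumes "wf_digraph G"
  shows "digraph_iso G G"
proof -
  let ?h = "\<lparr>iso_verts = id, iso_arcs = id, iso_head = head G, iso_tail = tail G\<rparr>"
  have "pre_digraph.digraph_isomorphism G ?h"
    unfolding pre_digraph.digraph_isomorphism_def using assms by simp
  moreover have "G = app_iso ?h G"
    unfolding app_iso_def by simp
  ultimately show ?thesis
    unfolding digraph_iso_def by blast
qed

lemma out_degree_with_proj:
  assumes "pair_wf_digraph G"
  shows "out_degree (with_proj G) v = card {w \<in> pverts G. (v, w) \<in> parcs G}"
proof -
  have "out_arcs (with_proj G) v = Pair v ` {w \<in> pverts G. (v, w) \<in> parcs G}"
    using pair_wf_digraph.in_arcsD2[OF assms] by (force simp: out_arcs_def)
  then show ?thesis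
    by (simp add: out_degree_def card_image inj_on_def)
qed

section \<open>Regularity of Cayley graphs and two concrete examples\<close>

context group
begin

lemma inv_mult_mem_iff:
  assumes "g \<in> carrier G" "h \<in> carrier G" "S \<subseteq> carrier G"
  shows "inv g \<otimes> h \<in> S \<longleftrightarrow> (\<exists>s \<in> S. h = g \<otimes> s)"
proof
  assume "inv g \<otimes> h \<in> S"
  then show "\<exists>s \<in> S. h = g \<otimes> s"
    using assms by (intro bexI[of _ "inv g \<otimes> h"]) (auto simp: m_assoc[symmetric])
next
  assume "\<exists>s \<in> S. h = g \<otimes> s"
  then show "inv g \<otimes> h \<in> S"
    using assms by (auto simp: m_assoc[symmetric] subset_eq)
qed

lemma pair_graph_cayley_graph_regular:
  assumes "finite (carrier G)" "S \<subseteq> carrier G" "\<one> \<notin> S" "\<And>s. s \<in> S \<Longrightarrow> inv s \<in> S"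
  shows "pair_graph (cayley_graph G S)" (is "pair_graph ?C")
    and "regular (card S) (cayley_graph G S)"
proof -
  have "finite (parcs ?C)"
    unfolding cayley_graph_def using assms(1)
    by (auto intro: finite_subset[of _ "carrier G \<times> carrier G"])
  moreover have "(h, g) \<in> parcs ?C" if "(g, h) \<in> parcs ?C" for g h
  proof -
    have gh: "g \<in> carrier G" "h \<in> carrier G" "inv g \<otimes> h \<in> S"
      using that unfolding cayley_graph_def by auto
    then have "inv (inv g \<otimes> h) \<in> S"
      using assms(4) by blast
    then show ?thesis
      using gh unfolding cayley_graph_def by (simp add: inv_mult_group)
  qed
  moreover have "g \<noteq> h" if "(g, h) \<in> parcs ?C" for g h
    using that assms(3) unfolding cayley_graph_def by auto
  ultimately show graph: "pair_graph ?C"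
    using assms(1)
    by unfold_locales (auto simp: cayley_graph_def symmetric_def sym_def arcs_ends_def arc_to_ends_def)
  show "regular (card S) ?C"
    unfolding regular_def
  proof
    fix g assume g: "g \<in> pverts ?C"
    have "{h \<in> pverts ?C. (g, h) \<in> parcs ?C} = {h \<in> carrier G. \<exists>s \<in> S. h = g \<otimes> s}"
      using g inv_mult_mem_iff[OF _ _ assms(2), of g] unfolding cayley_graph_def by auto
    also have "\<dots> = (\<lambda>s. g \<otimes> s) ` S"
      using g assms(2) unfolding cayley_graph_def by auto
    finally have "{h \<in> pverts ?C. (g, h) \<in> parcs ?C} = (\<lambda>s. g \<otimes> s) ` S" .
    moreover have "inj_on (\<lambda>s. g \<otimes> s) S"
      using g assms(2) unfolding cayley_graph_def by (auto intro!: inj_onI simp: subset_eq)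
    ultimately show "out_degree (with_proj ?C) g = card S"
      using graph by (simp add: out_degree_with_proj card_image pair_graph_def pair_digraph_def pair_fin_digraph_def)
  qed
qed

end

lemma is_cayley_graph_cayley_graph:
  fixes \<Gamma> :: "'a monoid"
  assumes "group \<Gamma>" "finite (carrier \<Gamma>)" "S \<subseteq> carrier \<Gamma>" "\<one>\<^bsub>\<Gamma>\<^esub> \<notin> S"
    and "\<And>s. s \<in> S \<Longrightarrow> inv\<^bsub>\<Gamma>\<^esub> s \<in> S"
  shows "is_cayley_graph (cayley_graph \<Gamma> S)"
proof -
  interpret pair_graph "cayley_graph \<Gamma> S"
    by (rule group.pair_graph_cayley_graph_regular(1)[OF assms])
  have "digraph_iso (with_proj (cayley_graph \<Gamma> S)) (with_proj (cayley_graph \<Gamma> S))"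
    by (rule digraph_iso_refl) unfold_locales
  then show ?thesis
    unfolding is_cayley_graph_def using assms by blast
qed

text \<open>
  The group $\mathbb{Z}_k \times \mathbb{Z}_2$, with \<open>i + k * b\<close> standing for the pair \<open>(i, b)\<close>.
  With the connection set \<open>{1..k}\<close> it yields the prism over the complete graph on \<open>k\<close> vertices.
\<close>

definition prism_group :: "nat \<Rightarrow> nat monoid" where
  "prism_group k = \<lparr>carrier = {..<2 * k},
     monoid.mult = (\<lambda>x y. (x + y) mod k + k * ((x div k + y div k) mod 2)), one = 0\<rparr>"

lemma prism_group_simps:
  "carrier (prism_group k) = {..<2 * k}"
  "x \<otimes>\<^bsub>prism_group k\<^esub> y = (x + y) mod k + k * ((x div k + y div k) mod 2)"
  "\<one>\<^bsub>prism_group k\<^esub> = 0"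
  unfolding prism_group_def by simp_all

lemma prism_mult_mod_div:
  assumes "0 < k"
  shows "(x \<otimes>\<^bsub>prism_group k\<^esub> y) mod k = (x + y) mod k"
    and "(x \<otimes>\<^bsub>prism_group k\<^esub> y) div k = (x div k + y div k) mod 2"
  using assms by (simp_all add: prism_group_simps)

text \<open>The inverse of \<open>(i, b)\<close> is \<open>(-i, b)\<close>; the outer
  \<open>mod k\<close> takes care of \<open>i = 0\<close>.\<close>

lemma prism_group_inverse:
  assumes "0 < k" "x < 2 * k"
  defines "y \<equiv> (k - x mod k) mod k + k * (x div k)"
  shows "y < 2 * k" "y \<otimes>\<^bsub>prism_group k\<^esub> x = 0"
proof -
  have x: "x div k < 2"
    using assms(1,2) by (simp add: less_mult_imp_div_less)
  have "k * (x div k) \<le> k * 1"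
    using x by (intro mult_le_mono2) simp
  moreover have "(k - x mod k) mod k < k"
    using assms(1) by simp
  ultimately show "y < 2 * k"
    unfolding y_def by linarith
  have "(y + x) mod k = (k - x mod k + x mod k) mod k"
    unfolding y_def by (intro mod_add_cong) simp_all
  also have "\<dots> = 0"
    using mod_less_divisor[OF assms(1), of x] by simp
  finally have "(y + x) mod k = 0" .
  moreover have "y div k = x div k"
    unfolding y_def using assms(1) by simp
  ultimately show "y \<otimes>\<^bsub>prism_group k\<^esub> x = 0"
    by (simp add: prism_group_simps flip: mult_2)
qed

lemma group_prism_group:
  assumes "0 < k"
  shows "group (prism_group k)"
proof (rule groupI)
  let ?G = "prism_group k"
  have lt: "a + k * (b mod 2) < 2 * k" if "a < k" for a b
  proof -
    have "k * (b mod 2) \<le> k * 1"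
      by (intro mult_le_mono2) simp
    then show ?thesis
      using that by linarith
  qed
  show "x \<otimes>\<^bsub>?G\<^esub> y \<in> carrier ?G" for x y
    using assms lt by (simp add: prism_group_simps)
  show "\<one>\<^bsub>?G\<^esub> \<in> carrier ?G"
    using assms by (simp add: prism_group_simps)
  show "x \<otimes>\<^bsub>?G\<^esub> y \<otimes>\<^bsub>?G\<^esub> z = x \<otimes>\<^bsub>?G\<^esub> (y \<otimes>\<^bsub>?G\<^esub> z)" for x y z
  proof -
    have "(x \<otimes>\<^bsub>?G\<^esub> y \<otimes>\<^bsub>?G\<^esub> z) mod k = (x + y + z) mod k"
      by (metis prism_mult_mod_div(1)[OF assms] mod_add_left_eq)
    moreover have "(x \<otimes>\<^bsub>?G\<^esub> (y \<otimes>\<^bsub>?G\<^esub> z)) mod k = (x + y + z) mod k"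
      by (metis prism_mult_mod_div(1)[OF assms] mod_add_right_eq add.assoc)
    moreover have "(x \<otimes>\<^bsub>?G\<^esub> y \<otimes>\<^bsub>?G\<^esub> z) div k = (x \<otimes>\<^bsub>?G\<^esub> (y \<otimes>\<^bsub>?G\<^esub> z)) div k"
      by (simp only: prism_mult_mod_div(2)[OF assms] mod_add_left_eq mod_add_right_eq add.assoc)
    ultimately show ?thesis
      by (metis div_mult_mod_eq)
  qed
  show "\<one>\<^bsub>?G\<^esub> \<otimes>\<^bsub>?G\<^esub> x = x" if "x \<in> carrier ?G" for x
  proof -
    have "x div k < 2"
      using that by (simp add: prism_group_simps less_mult_imp_div_less)
    then show ?thesis
      by (simp add: prism_group_simps)
  qed
  show "\<exists>y \<in> carrier ?G. y \<otimes>\<^bsub>?G\<^esub> x = \<one>\<^bsub>?G\<^esub>" if "x \<in> carrier ?G" for x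
    using prism_group_inverse[OF assms, of x] that unfolding prism_group_simps(1,3) by blast
qed

text \<open>The numbers below \<open>k\<close> stand for the pairs \<open>(i, 0)\<close> with
  nonzero \<open>i\<close>, and \<open>k\<close> stands for \<open>(0, 1)\<close>, the rung of the
  prism, which is its own inverse.\<close>

lemma prism_connection_set:
  assumes "2 \<le> k"
  shows "{1..k} \<subseteq> carrier (prism_group k)" "\<one>\<^bsub>prism_group k\<^esub> \<notin> {1..k}"
    and "\<And>s. s \<in> {1..k} \<Longrightarrow> inv\<^bsub>prism_group k\<^esub> s \<in> {1..k}"
proof -
  interpret group "prism_group k"
    using group_prism_group assms by simp
  show S: "{1..k} \<subseteq> carrier (prism_group k)" "\<one>\<^bsub>prism_group k\<^esub> \<notin> {1..k}"
    using assms by (auto simp: prism_group_simps)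
  show "inv\<^bsub>prism_group k\<^esub> s \<in> {1..k}" if s: "s \<in> {1..k}" for s
  proof (cases "s = k")
    case True
    have "inv\<^bsub>prism_group k\<^esub> k = k"
      using assms by (intro inv_equality) (simp_all add: prism_group_simps)
    then show ?thesis
      using True assms by simp
  next
    case False
    then have "inv\<^bsub>prism_group k\<^esub> s = k - s"
      using s by (intro inv_equality) (auto simp: prism_group_simps)
    then show ?thesis
      using False s by auto
  qed
qed

text \<open>The colour of \<open>(i, b)\<close> is \<open>i + b\<close> modulo \<open>k\<close>: an
  arc within a layer shifts it by a nonzero residue, a rung by one up or down. One layer is a clique
  on \<open>k\<close> vertices, so fewer colours do not suffice.\<close>

lemma chromatic_number_prism:
  assumes "2 \<le> k"
  shows "chromatic_number (cayley_graph (prism_group k) {1..k}) = k" (is "chromatic_number ?G = k")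
proof (rule chromatic_number_eqI)
  interpret group "prism_group k"
    using group_prism_group assms by simp
  have k: "0 < k"
    using assms by simp
  have arcs: "(g, h) \<in> parcs ?G \<longleftrightarrow>
      g < 2 * k \<and> h < 2 * k \<and> (\<exists>s \<in> {1..k}. h = g \<otimes>\<^bsub>prism_group k\<^esub> s)" for g h
    using inv_mult_mem_iff[OF _ _ prism_connection_set(1)[OF assms], of g h]
    unfolding cayley_graph_def by (auto simp: prism_group_simps(1))
  have shift: "(a + s) mod k \<noteq> a mod k" if "0 < s" "s < k" for a s :: nat
  proof
    assume "(a + s) mod k = a mod k"
    then have "k dvd s"
      by (metis add_diff_cancel_left' le_add1 mod_eq_dvd_iff_nat)
    then show False
      using that by (auto dest: dvd_imp_le)
  qed
  show "proper_colouring ?G k (\<lambda>x. (x mod k + x div k) mod k)"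
    unfolding proper_colouring_def
  proof (intro conjI ballI)
    show "(x mod k + x div k) mod k < k" for x
      using k by simp
    fix e assume e: "e \<in> parcs ?G"
    obtain g h where gh: "e = (g, h)"
      by (cases e)
    then obtain s where s: "1 \<le> s" "s \<le> k" "h = g \<otimes>\<^bsub>prism_group k\<^esub> s" and g: "g < 2 * k"
      using e arcs by auto
    have h: "h mod k = (g + s) mod k" "h div k = (g div k + s div k) mod 2"
      unfolding s(3) by (simp_all add: prism_mult_mod_div[OF k])
    have g2: "g div k < 2"
      using g by (simp add: less_mult_imp_div_less)
    have "(g mod k + g div k) mod k \<noteq> (h mod k + h div k) mod k"
    proof (cases "s = k")
      case False
      then have "(h mod k + h div k) mod k = (g + (g div k + s)) mod k"
        using s(2) g2 h by (simp add: mod_simps ac_simps)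
      also have "\<dots> = (g mod k + g div k + s) mod k"
        by (simp add: mod_add_left_eq add.assoc)
      finally show ?thesis
        using shift[of s "g mod k + g div k"] s(1,2) False by simp
    next
      case True
      then have hk: "h mod k = g mod k" "h div k = (g div k + 1) mod 2"
        using h k by simp_all
      consider "g div k = 0" "h div k = 1" | "g div k = 1" "h div k = 0"
        using less_2_cases[OF g2] hk(2) by auto
      then show ?thesis
        using shift[of 1 "g mod k"] assms hk(1) by cases auto
    qed
    then show "case e of (u, v) \<Rightarrow> (u mod k + u div k) mod k \<noteq> (v mod k + v div k) mod k"
      using gh by simp
  qed
  show "k \<le> m" if m: "proper_colouring ?G m c" for m c
  proof -
    have "(i, j) \<in> parcs ?G" if "i < j" "j < k" for i j
      unfolding arcs using that by (auto simp: prism_group_simps intro!: bexI[of _ "j - i"])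
    then have "c i \<noteq> c j" if "i < j" "j < k" for i j
      using that m unfolding proper_colouring_def by blast
    then have "inj_on c {..<k}"
      by (metis inj_onI lessThan_iff linorder_neq_iff)
    moreover have "c ` {..<k} \<subseteq> {..<m}"
      using m unfolding proper_colouring_def cayley_graph_def by (auto simp: prism_group_simps)
    ultimately show ?thesis
      using card_inj_on_le[of c "{..<k}" "{..<m}"] by simp
  qed
qed

lemma prism_r_chi_graph:
  assumes "2 \<le> k"
  defines "G \<equiv> cayley_graph (prism_group k) {1..k}"
  shows "r_chi_graph k k G" "is_cayley_graph G" "card (pverts G) = 2 * k"
proof -
  have grp: "group (prism_group k)" and fin: "finite (carrier (prism_group k))"
    using group_prism_group assms(1) by (simp_all add: prism_group_simps)
  note S = prism_connection_set[OF assms(1)]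
  show "r_chi_graph k k G"
    using group.pair_graph_cayley_graph_regular[OF grp fin S] chromatic_number_prism[OF assms(1)]
    unfolding r_chi_graph_def G_def by simp
  show "is_cayley_graph G"
    using is_cayley_graph_cayley_graph[OF grp fin S] unfolding G_def .
  show "card (pverts G) = 2 * k"
    unfolding G_def cayley_graph_def by (simp add: prism_group_simps)
qed

definition cyclic7 :: "nat monoid" where
  "cyclic7 = \<lparr>carrier = {..<7}, monoid.mult = (\<lambda>x y. (x + y) mod 7), one = 0\<rparr>"

lemma cyclic7_simps:
  "carrier cyclic7 = {..<7}" "x \<otimes>\<^bsub>cyclic7\<^esub> y = (x + y) mod 7" "\<one>\<^bsub>cyclic7\<^esub> = 0"
  unfolding cyclic7_def by simp_all

lemma group_cyclic7: "group cyclic7"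
proof (rule groupI)
  show "\<exists>y \<in> carrier cyclic7. y \<otimes>\<^bsub>cyclic7\<^esub> x = \<one>\<^bsub>cyclic7\<^esub>" if "x \<in> carrier cyclic7" for x
    using that by (intro bexI[of _ "(7 - x) mod 7"]) (auto simp: cyclic7_simps mod_simps)
qed (auto simp: cyclic7_simps mod_simps add.assoc)

text \<open>
  This graph is the complement of the 7-cycle, whose cliques have at most two vertices.
\<close>

lemma cyclic7_r_chi_graph:
  defines "G \<equiv> cayley_graph cyclic7 {2..5}"
  shows "r_chi_graph 4 4 G" "is_cayley_graph G" "card (pverts G) = 7"
proof -
  interpret group cyclic7
    by (rule group_cyclic7)
  have fin: "finite (carrier cyclic7)"
    by (simp add: cyclic7_simps)
  have S: "{2..5} \<subseteq> carrier cyclic7" "\<one>\<^bsub>cyclic7\<^esub> \<notin> {2..5}"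
    by (auto simp: cyclic7_simps)
  have inv_S: "inv\<^bsub>cyclic7\<^esub> s \<in> {2..5}" if "s \<in> {2..5}" for s
  proof -
    have "inv\<^bsub>cyclic7\<^esub> s = 7 - s"
      using that by (intro inv_equality) (simp_all add: cyclic7_simps)
    then show ?thesis
      using that by auto
  qed
  have arcs: "(g, h) \<in> parcs G \<longleftrightarrow> g < 7 \<and> h < 7 \<and> (\<exists>s \<in> {2..5}. h = (g + s) mod 7)" for g h
    using inv_mult_mem_iff[OF _ _ S(1), of g h]
    unfolding cayley_graph_def G_def by (auto simp: cyclic7_simps(1,2))
  have "chromatic_number G = 4"
  proof (rule chromatic_number_eqI)
    have "g div 2 \<noteq> h div 2" if "(g, h) \<in> parcs G" for g h
    proof -
      obtain s where s: "g < 7" "h < 7" "2 \<le> s" "s \<le> 5" "h = (g + s) mod 7"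
        using \<open>(g, h) \<in> parcs G\<close> arcs by auto
      then have "h = g + s \<or> g + s = h + 7"
        by (cases "g + s < 7") (auto simp: le_mod_geq)
      then show ?thesis
        using s(3,4) by linarith
    qed
    then show "proper_colouring G 4 (\<lambda>x. x div 2)"
      unfolding proper_colouring_def G_def cayley_graph_def by (auto simp: cyclic7_simps)
    show "4 \<le> m" if m: "proper_colouring G m c" for m c
    proof (rule ccontr)
      assume "\<not> 4 \<le> m"
      moreover have "c x < m" if "x < 7" for x
        using m that unfolding proper_colouring_def G_def cayley_graph_def
        by (simp add: cyclic7_simps)
      ultimately have c3: "c x < 3" if "x < 7" for x
        using that by fastforce
      have ne: "c g \<noteq> c h" if "g + 2 \<le> h" "h \<le> g + 5" "h < 7" for g h
      proof -
        have "h = (g + (h - g)) mod 7" "h - g \<in> {2..5}"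
          using that by auto
        then have "(g, h) \<in> parcs G"
          using arcs that by (metis le_add1 order_le_less_trans order_trans)
        then show ?thesis
          using m unfolding proper_colouring_def by auto
      qed
      have lt: "c 0 < 3" "c 1 < 3" "c 2 < 3" "c 3 < 3" "c 4 < 3" "c 5 < 3" "c 6 < 3"
        by (rule c3; simp)+
      \<comment> \<open>The triangle \<open>0, 2, 4\<close> uses up three colours. This forces the
        colours of \<open>5\<close>, \<open>6\<close> and \<open>1\<close> in turn, and the
        neighbours \<open>0\<close>, \<open>1\<close>, \<open>5\<close> of \<open>3\<close> then
        show all three.\<close>
      have tri: "c 0 \<noteq> c 2" "c 0 \<noteq> c 4" "c 2 \<noteq> c 4"
        by (rule ne; simp)+
      have "c 0 \<noteq> c 5" "c 2 \<noteq> c 5"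
        by (rule ne; simp)+
      then have eq5: "c 5 = c 4"
        using tri lt by linarith
      have "c 2 \<noteq> c 6" "c 4 \<noteq> c 6"
        by (rule ne; simp)+
      then have eq6: "c 6 = c 0"
        using tri lt by linarith
      have "c 1 \<noteq> c 4" "c 1 \<noteq> c 6"
        by (rule ne; simp)+
      then have eq1: "c 1 = c 2"
        using tri lt eq6 by linarith
      have "c 0 \<noteq> c 3" "c 1 \<noteq> c 3" "c 3 \<noteq> c 5"
        by (rule ne; simp)+
      then show False
        using tri lt eq1 eq5 by linarith
    qed
  qed
  then show "r_chi_graph 4 4 G"
    using pair_graph_cayley_graph_regular[OF fin S inv_S] unfolding r_chi_graph_def G_def by simp
  show "is_cayley_graph G"
    using is_cayley_graph_cayley_graph[OF group_cyclic7 fin S inv_S] unfolding G_def .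
  show "card (pverts G) = 7"
    unfolding G_def cayley_graph_def by (simp add: cyclic7_simps)
qed

section \<open>Minimum orders\<close>

lemma clique_cover_colouring:
  assumes "pair_graph G" "clique_cover (\<lambda>u v. u \<noteq> v \<and> (u, v) \<notin> parcs G) m (pverts G)"
  obtains f where "proper_colouring G m f"
proof -
  interpret pair_graph G by (rule assms(1))
  obtain f where "\<forall>v \<in> pverts G. f v < m"
      "\<forall>u \<in> pverts G. \<forall>v \<in> pverts G. f u = f v \<longrightarrow> u \<noteq> v \<longrightarrow> u \<noteq> v \<and> (u, v) \<notin> parcs G"
    using assms(2) unfolding clique_cover_def by blast
  moreover have "u \<in> pverts G" "v \<in> pverts G" "u \<noteq> v" if "(u, v) \<in> parcs G" for u v
    using that in_arcsD1 in_arcsD2 pair_no_loops[OF that] by auto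
  ultimately have "proper_colouring G m f"
    unfolding proper_colouring_def by blast
  then show ?thesis
    by (rule that)
qed

lemma r_chi_graph_order:
  fixes G :: "nat pair_pre_digraph"
  assumes "r_chi_graph k k G" "3 \<le> k"
  shows "2 * k - 1 \<le> card (pverts G)"
    and "card (pverts G) = 2 * k - 1 \<Longrightarrow> k \<in> {4, 6, 8, 10, 12}"
proof -
  have graph: "pair_graph G" and reg: "regular k G" and chi: "chromatic_number G = k"
    using assms(1) unfolding r_chi_graph_def by auto
  interpret G: pair_graph G by (rule graph)
  let ?V = "pverts G"
  define E where "E u v \<longleftrightarrow> u \<noteq> v \<and> (u, v) \<notin> parcs G" for u v
  have finV: "finite ?V"
    by simp
  have arc_sym: "(v, u) \<in> parcs G" if "(u, v) \<in> parcs G" for u v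
    using G.pair_sym_arcs that unfolding symmetric_def by (auto dest: symD)
  have "symp E" "irreflp E"
    unfolding E_def by (auto intro!: sympI irreflpI dest: arc_sym)
  have nbh_compl: "card (nbh E ?V x) = card ?V - 1 - k" and k_less: "k + 1 \<le> card ?V"
    if x: "x \<in> ?V" for x
  proof -
    let ?N = "{w \<in> ?V. (x, w) \<in> parcs G}"
    have N: "card ?N = k"
      using reg x out_degree_with_proj[OF G.pair_wf_digraph_axioms] unfolding regular_def by metis
    have "?N \<subseteq> ?V - {x}"
      using G.pair_no_loops by fastforce
    moreover have card_x: "card (?V - {x}) = card ?V - 1"
      using x by simp
    moreover have "nbh E ?V x = (?V - {x}) - ?N"
      unfolding nbh_def E_def by auto
    ultimately show "card (nbh E ?V x) = card ?V - 1 - k"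
      using N finV by (metis (no_types, lifting) card_Diff_subset finite_Diff finite_subset)
    have "0 < card ?V"
      using x finV by (auto simp: card_gt_0_iff)
    moreover have "k \<le> card ?V - 1"
      using card_mono[of "?V - {x}" ?N] \<open>?N \<subseteq> ?V - {x}\<close> N finV card_x by simp
    ultimately show "k + 1 \<le> card ?V"
      by linarith
  qed
  have no_cover: "\<not> clique_cover E (k - 1) ?V"
  proof
    assume "clique_cover E (k - 1) ?V"
    then obtain f where "proper_colouring G (k - 1) f"
      using clique_cover_colouring[OF graph] unfolding E_def by blast
    then show False
      using chromatic_number_le[of G "k - 1" f] chi assms(2) by linarith
  qed
  have "?V \<noteq> {}"
    using no_cover unfolding clique_cover_def by auto
  then obtain x where x: "x \<in> ?V" by auto
  define d where "d = card ?V - 1 - k"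
  have n: "card ?V = k + 1 + d"
    using k_less[OF x] unfolding d_def by simp
  \<comment> \<open>For \<open>d = 0\<close> the graph is complete on \<open>k + 1\<close> vertices
    and would need \<open>k + 1\<close> colours; the covering results require a positive
    degree.\<close>
  have "d \<noteq> 0"
  proof
    assume d0: "d = 0"
    have "clique_cover E (card ?V) ?V"
      using finV by (rule clique_cover_singletons)
    then obtain f where "proper_colouring G (card ?V) f"
      using clique_cover_colouring[OF graph] unfolding E_def by blast
    then obtain g where g: "proper_colouring G k g"
      using chromatic_number_colouring[of G "card ?V" f] chi by auto
    have "\<not> E u v" if "u \<in> ?V" "v \<in> ?V" for u v
    proof -
      have "nbh E ?V u = {}"
        using nbh_compl[OF that(1)] d0 finV unfolding d_def by simp
      then show ?thesis
        using that(2) unfolding nbh_def by auto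
    qed
    then have "inj_on g ?V"
      using g unfolding proper_colouring_def E_def by (intro inj_onI) blast
    moreover have "g ` ?V \<subseteq> {..<k}"
      using g unfolding proper_colouring_def by auto
    ultimately have "card ?V \<le> k"
      using card_inj_on_le[of g ?V "{..<k}"] by simp
    then show False
      using n by simp
  qed
  interpret regular_rel ?V E d
    using finV \<open>symp E\<close> \<open>irreflp E\<close> nbh_compl unfolding d_def by unfold_locales auto
  show order: "2 * k - 1 \<le> card ?V"
  proof (rule ccontr)
    assume "\<not> ?thesis"
    then have "2 * d + 4 \<le> card ?V"
      using n by linarith
    moreover have "card ?V - d - 2 = k - 1"
      using n by simp
    ultimately show False
      using clique_cover_large_order no_cover \<open>d \<noteq> 0\<close> by auto
  qed
  show "k \<in> {4, 6, 8, 10, 12}" if order: "card ?V = 2 * k - 1"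
  proof (rule ccontr)
    assume k: "k \<notin> {4, 6, 8, 10, 12}"
    have d: "d + 2 = k"
      using n order assms(2) by linarith
    then have V: "card ?V = 2 * d + 3"
      using n by simp
    then have "even d"
      using even_card_mult_degree by simp
    \<comment> \<open>\<open>k = d + 2\<close> is even, at least \<open>3\<close> and none of the
      listed values, so it is at least \<open>14\<close>.\<close>
    then have "12 \<le> d"
      using k d assms(2) by (auto elim!: evenE)
    moreover have "d + 1 = k - 1"
      using d by simp
    ultimately show False
      using clique_cover_even_degree[OF \<open>even d\<close> _ V] no_cover by simp
  qed
qed

text \<open>The prism shows that both sets of orders are nonempty. Hence the infima are attained and
  are not the default value \<open>0\<close>, and the inclusion of the sets compares them.\<close>

lemma min_order_bounds:
  assumes "3 \<le> k"
  shows "2 * k - 1 \<le> min_order k k" "min_order k k \<le> min_cayley_order k k"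
    and "min_order k k = 2 * k - 1 \<Longrightarrow> k \<in> {4, 6, 8, 10, 12}"
    and "\<And>G :: nat pair_pre_digraph.
      r_chi_graph k k G \<Longrightarrow> is_cayley_graph G \<Longrightarrow> min_cayley_order k k \<le> card (pverts G)"
proof -
  let ?A = "{card (pverts G) | G :: nat pair_pre_digraph. r_chi_graph k k G}"
  let ?B = "{card (pverts G) | G :: nat pair_pre_digraph. r_chi_graph k k G \<and> is_cayley_graph G}"
  have B: "2 * k \<in> ?B"
    using prism_r_chi_graph[of k] assms by (auto intro!: exI[of _ "cayley_graph (prism_group k) {1..k}"])
  have BA: "?B \<subseteq> ?A"
    by blast
  have "min_order k k \<in> ?A"
    unfolding min_order_def using B BA by (intro Inf_nat_def1) blast
  then obtain G :: "nat pair_pre_digraph" where G: "r_chi_graph k k G" "min_order k k = card (pverts G)"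
    by blast
  show "2 * k - 1 \<le> min_order k k" "min_order k k = 2 * k - 1 \<Longrightarrow> k \<in> {4, 6, 8, 10, 12}"
    using r_chi_graph_order[OF G(1) assms] G(2) by auto
  show "min_order k k \<le> min_cayley_order k k"
    unfolding min_order_def min_cayley_order_def using B BA by (intro cInf_superset_mono) auto
  show "min_cayley_order k k \<le> card (pverts G)"
    if "r_chi_graph k k G" "is_cayley_graph G" for G :: "nat pair_pre_digraph"
    unfolding min_cayley_order_def using that by (intro cInf_lower) auto
qed

theorem theorem6:
  shows "(\<forall>k::nat. k \<ge> 3 \<and> k \<notin> {4, 6, 8, 10, 12} \<longrightarrow>
            min_order k k = 2 * k \<and> min_cayley_order k k = 2 * k)
       \<and> (min_order 4 4 = 7 \<and> min_cayley_order 4 4 = 7)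
       \<and> (\<forall>k \<in> {6, 8, 10, 12 :: nat}.
            2 * k - 1 \<le> min_order k k \<and> min_order k k \<le> min_cayley_order k k \<and>
            min_cayley_order k k \<le> 2 * k)"
proof -
  have upper: "min_cayley_order k k \<le> 2 * k" if "3 \<le> k" for k
    using min_order_bounds(4)[OF that] prism_r_chi_graph[of k] that by fastforce
  have "min_order k k = 2 * k \<and> min_cayley_order k k = 2 * k"
    if "3 \<le> k" "k \<notin> {4, 6, 8, 10, 12}" for k
    using min_order_bounds(1-3)[OF that(1)] upper[OF that(1)] that(2) by linarith
  moreover have "min_order 4 4 = 7 \<and> min_cayley_order 4 4 = 7"
  proof -
    have "min_cayley_order 4 4 \<le> 7"
      using min_order_bounds(4)[of 4] cyclic7_r_chi_graph by fastforce
    moreover have "7 \<le> min_order 4 4" "min_order 4 4 \<le> min_cayley_order 4 4"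
      using min_order_bounds(1,2)[of 4] by simp_all
    ultimately show ?thesis by linarith
  qed
  moreover have "2 * k - 1 \<le> min_order k k \<and> min_order k k \<le> min_cayley_order k k \<and>
      min_cayley_order k k \<le> 2 * k" if "k \<in> {6, 8, 10, 12 :: nat}" for k
    using min_order_bounds(1,2)[of k] upper[of k] that by auto
  ultimately show ?thesis
    by blast
qed


end
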